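(* Let $(\Omega_1,\mathcal{F}_1,\mu_1)$ and $(\Omega_2,\mathcal{F}_2,\mu_2)$ be measure spaces with (finite or infinite) $\sigma$-finite non-atomic measures such that $\mu_1(\Omega_1)=\mu_2(\Omega_2)$, and let $\mathbf{E}_1=\mathbf{E}_1(\Omega_1,\mathcal{F}_1,\mu_1)$ be a symmetric space on $(\Omega_1,\mathcal{F}_1,\mu_1)$. Then there exists a unique symmetric space $\mathbf{E}_2=\mathbf{E}_2(\Omega_2,\mathcal{F}_2,\mu_2)$ on $(\Omega_2,\mathcal{F}_2,\mu_2)$ which is equimeasurable to $\mathbf{E}_1$.
   Context: All measure spaces $(\Omega,\mathcal{F},\mu)$ are assumed $\mu$-complete, with finite or infinite $\sigma$-finite non-atomic measure $\mu$. $\mathbf{L}_0(\Omega,\mathcal{F},\mu)$ is the space of $\mu$-a.e. equivalence classes of measurable functions $f\colon\Omega\to\mathbb{R}$. For $f\in\mathbf{L}_0(\Omega,\mathcal{F},\mu)$ the distribution function is $\eta_{f,\mu}(x)=\mu(\{|f|>x\})$, $x\ge 0$, and the decreasing rearrangement is $\xi_{f,\mu}(x)=\inf\{y\in[0,\infty):\eta_{f,\mu}(y)\le x\}$, $x\ge 0$ (with $\inf\emptyset=+\infty$). A symmetric space on $(\Omega,\mathcal{F},\mu)$ is a non-trivial Banach or quasi-Banach space $(\mathbf{E},\|\cdot\|_{\mathbf{E}})$, $\mathbf{E}=\mathbf{E}(\Omega,\mathcal{F},\mu)$, of real measurable functions (a linear subspace of $\mathbf{L}_0(\Omega,\mathcal{F},\mu)$)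 such that: (1) if $f\in\mathbf{L}_0(\Omega,\mathcal{F},\mu)$, $g\in\mathbf{E}$ and $|f|\le|g|$, then $f\in\mathbf{E}$ and $\|f\|_{\mathbf{E}}\le\|g\|_{\mathbf{E}}$; (2) if $f\in\mathbf{L}_0(\Omega,\mathcal{F},\mu)$, $g\in\mathbf{E}$ and $\eta_{f,\mu}=\eta_{g,\mu}$, then $f\in\mathbf{E}$ and $\|f\|_{\mathbf{E}}=\|g\|_{\mathbf{E}}$. Two symmetric spaces $\mathbf{E}_1(\Omega_1,\mathcal{F}_1,\mu_1)$ and $\mathbf{E}_2(\Omega_2,\mathcal{F}_2,\mu_2)$ are called equimeasurable if they have the same collections of decreasing rearrangements: $\{\xi_{f_1,\mu_1}: f_1\in\mathbf{E}_1\}=\{\xi_{f_2,\mu_2}: f_2\in\mathbf{E}_2\}$.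
   Formalization: Uniqueness means the same set of functions with equivalent quasi-norms: equimeasurability ignores the norm, so doubling the norm of E_2 gives another equimeasurable symmetric space and literal uniqueness of the normed space fails. *)

theory Defs
  imports "HOL-Analysis.Analysis"
begin

definition measure_atom :: "'a measure \<Rightarrow> 'a set \<Rightarrow> bool" where
  "measure_atom M A \<longleftrightarrow> A \<in> sets M \<and> emeasure M A > 0 \<and>
     (\<forall>B \<in> sets M. B \<subseteq> A \<longrightarrow> emeasure M B = 0 \<or> emeasure M (A - B) = 0)"

locale nonatomic_measure_space = complete_measure M + sigma_finite_measure M
  for M :: "'a measure" +
  assumes nonatomic: "\<not> measure_atom M A"

text \<open>The distribution function and the decreasing rearrangement have domain \<open>[0, \<infinity>)\<close>;
  \<open>restrict\<close> makes equality of such functions mean equality on that domain.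
  In \<open>ennreal\<close>, \<open>Inf {} = \<infinity>\<close>.\<close>

definition distribution_fun :: "'a measure \<Rightarrow> ('a \<Rightarrow> real) \<Rightarrow> real \<Rightarrow> ennreal" where
  "distribution_fun M f = (\<lambda>x\<in>{0..}. emeasure M {\<omega> \<in> space M. \<bar>f \<omega>\<bar> > x})"

definition decr_rearrangement :: "'a measure \<Rightarrow> ('a \<Rightarrow> real) \<Rightarrow> real \<Rightarrow> ennreal" where
  "decr_rearrangement M f =
     (\<lambda>x\<in>{0..}. Inf {ennreal y | y. y \<ge> 0 \<and> distribution_fun M f y \<le> ennreal x})"

text \<open>A linear subspace of \<open>L\<^sub>0\<close> is represented by the set of all representatives of its
  members, that is, by a set of measurable functions closed under almost everywhere equality.
  Equality of two such sets is equality of the corresponding sets of equivalence classes.\<close>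

definition L0_subspace :: "'a measure \<Rightarrow> ('a \<Rightarrow> real) set \<Rightarrow> bool" where
  "L0_subspace M E \<longleftrightarrow>
     E \<subseteq> borel_measurable M \<and>
     (\<forall>f \<in> borel_measurable M. \<forall>g \<in> E. (AE \<omega> in M. f \<omega> = g \<omega>) \<longrightarrow> f \<in> E) \<and>
     (\<lambda>\<omega>. 0) \<in> E \<and>
     (\<forall>f \<in> E. \<forall>g \<in> E. (\<lambda>\<omega>. f \<omega> + g \<omega>) \<in> E) \<and>
     (\<forall>c. \<forall>f \<in> E. (\<lambda>\<omega>. c * f \<omega>) \<in> E)"

text \<open>The values of \<open>N\<close> outside \<open>E\<close> are irrelevant. A norm is the case \<open>K = 1\<close>, so Banach
  spaces are included in the following definition.\<close>

definition quasi_norm_on :: "'a measure \<Rightarrow> ('a \<Rightarrow> real) set \<Rightarrow> (('a \<Rightarrow> real) \<Rightarrow> real) \<Rightarrow> bool" where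
  "quasi_norm_on M E N \<longleftrightarrow>
     (\<forall>f \<in> E. \<forall>g \<in> E. (AE \<omega> in M. f \<omega> = g \<omega>) \<longrightarrow> N f = N g) \<and>
     (\<forall>f \<in> E. N f \<ge> 0) \<and>
     (\<forall>f \<in> E. N f = 0 \<longleftrightarrow> (AE \<omega> in M. f \<omega> = 0)) \<and>
     (\<forall>c. \<forall>f \<in> E. N (\<lambda>\<omega>. c * f \<omega>) = \<bar>c\<bar> * N f) \<and>
     (\<exists>K \<ge> 1. \<forall>f \<in> E. \<forall>g \<in> E. N (\<lambda>\<omega>. f \<omega> + g \<omega>) \<le> K * (N f + N g))"

definition quasi_norm_complete :: "('a \<Rightarrow> real) set \<Rightarrow> (('a \<Rightarrow> real) \<Rightarrow> real) \<Rightarrow> bool" where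
  "quasi_norm_complete E N \<longleftrightarrow>
     (\<forall>f :: nat \<Rightarrow> 'a \<Rightarrow> real.
        (\<forall>n. f n \<in> E) \<and>
        (\<forall>e > 0. \<exists>n0. \<forall>m \<ge> n0. \<forall>n \<ge> n0. N (\<lambda>\<omega>. f m \<omega> - f n \<omega>) < e) \<longrightarrow>
        (\<exists>g \<in> E. (\<lambda>n. N (\<lambda>\<omega>. f n \<omega> - g \<omega>)) \<longlonglongrightarrow> 0))"

definition symmetric_space :: "'a measure \<Rightarrow> ('a \<Rightarrow> real) set \<Rightarrow> (('a \<Rightarrow> real) \<Rightarrow> real) \<Rightarrow> bool" where
  "symmetric_space M E N \<longleftrightarrow>
     L0_subspace M E \<and> quasi_norm_on M E N \<and> quasi_norm_complete E N \<and>
     (\<exists>f \<in> E. \<not> (AE \<omega> in M. f \<omega> = 0)) \<and>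
     (\<forall>f \<in> borel_measurable M. \<forall>g \<in> E.
        (AE \<omega> in M. \<bar>f \<omega>\<bar> \<le> \<bar>g \<omega>\<bar>) \<longrightarrow> f \<in> E \<and> N f \<le> N g) \<and>
     (\<forall>f \<in> borel_measurable M. \<forall>g \<in> E.
        distribution_fun M f = distribution_fun M g \<longrightarrow> f \<in> E \<and> N f = N g)"

definition equimeasurable ::
  "'a measure \<Rightarrow> ('a \<Rightarrow> real) set \<Rightarrow> 'b measure \<Rightarrow> ('b \<Rightarrow> real) set \<Rightarrow> bool" where
  "equimeasurable M1 E1 M2 E2 \<longleftrightarrow> decr_rearrangement M1 ` E1 = decr_rearrangement M2 ` E2"

text \<open>Equimeasurability does not involve the quasi-norm, so rescaling the quasi-norm of a
  symmetric space preserves it. Two symmetric spaces are therefore identified when they agree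
  as quasi-Banach spaces: the same functions and equivalent quasi-norms.\<close>

definition same_quasi_banach_space ::
  "('a \<Rightarrow> real) set \<Rightarrow> (('a \<Rightarrow> real) \<Rightarrow> real) \<Rightarrow> ('a \<Rightarrow> real) set \<Rightarrow> (('a \<Rightarrow> real) \<Rightarrow> real) \<Rightarrow> bool" where
  "same_quasi_banach_space E N E' N' \<longleftrightarrow>
     E = E' \<and> (\<exists>c > 0. \<exists>C > 0. \<forall>f \<in> E. c * N f \<le> N' f \<and> N' f \<le> C * N f)"

end

theory Submission
  imports Defs
begin

text \<open>On a nonatomic space a maximal chain of sets ordered by strict growth of the measure attains
  every measure below the total one, which yields a uniformly distributed function \<open>\<phi>\<close>. Composing
  decreasing rearrangements with \<open>\<phi>\<close> realises every relevant distribution function on either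
  space. So \<open>E\<^sub>2\<close> has to consist of the functions whose distribution function occurs in \<open>E\<^sub>1\<close>,
  with the quasi-norm carried over.

  Only the quasi-triangle inequality and completeness are not immediate. Both follow from one
  principle: if \<open>\<bar>g\<bar>\<close> is pointwise dominated by some member of a sequence whose quasi-norms decay
  geometrically, cut \<open>g\<close> into the pieces dominated by the individual members, move the pieces to
  disjoint subsets of \<open>\<Omega>\<^sub>1\<close>, and sum them there using completeness of \<open>E\<^sub>1\<close>. No joint
  distributions have to be transferred, at the price of a larger quasi-norm constant.

  Two complete lattice quasi-norms on the same space are equivalent: otherwise a sequence small
  for one and large for the other has an order bound, by completeness for the first.\<close>


section \<open>Functions with uniform distribution on nonatomic measure spaces\<close>

lemma ennreal_less_add_right:
  fixes a b :: ennreal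
  assumes "a < \<infinity>" "b \<noteq> 0"
  shows "a < a + b"
  using assms by (cases a; cases b) (auto simp: ennreal_plus[symmetric] ennreal_less_iff simp del: ennreal_plus)

section \<open>Intermediate values and uniformly distributed functions on a nonatomic space\<close>

context nonatomic_measure_space
begin

lemma split_positive:
  assumes "A \<in> sets M" "emeasure M A > 0"
  obtains B where "B \<in> sets M" "B \<subseteq> A" "emeasure M B > 0" "emeasure M (A - B) > 0"
  using nonatomic[of A] assms unfolding measure_atom_def by (auto simp: zero_less_iff_neq_zero)

text \<open>Sigma-finiteness enters here: a set of infinite measure contains sets of finite measure
  above any given bound.\<close>

lemma finite_positive_subset:
  assumes "A \<in> sets M" "emeasure M A > 0"
  obtains B where "B \<in> sets M" "B \<subseteq> A" "emeasure M B > 0" "emeasure M B < \<infinity>"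
proof (cases "emeasure M A = \<infinity>")
  case True
  from approx_PInf_emeasure_with_finite[OF assms(1) True, of 1] obtain Z
    where "Z \<in> sets M" "Z \<subseteq> A" "emeasure M Z < \<infinity>" "emeasure M Z > ennreal 1" by auto
  thus ?thesis using that[of Z] by (simp add: order.strict_trans[OF ennreal_zero_less_one])
next
  case False
  thus ?thesis using that[of A] assms by (simp add: less_top)
qed

text \<open>The Hausdorff maximal principle gives a maximal chain for inclusion with strict growth
  of the measure. If it missed a value \<open>t\<close>, its members below \<open>t\<close> and its
  members above \<open>t\<close> (or \<open>A\<close>, if there are none) would leave a gap of
  positive measure, which a nonatomic split fills with a new member. Demanding measures strictly
  below that of \<open>A\<close> keeps every member finite, so differences and intersections can be
  measured.\<close>

lemma chain_of_all_measures:
  assumes A: "A \<in> sets M"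
  obtains C where "C \<subseteq> {B \<in> sets M. B \<subseteq> A \<and> emeasure M B < emeasure M A}"
    and "\<And>B B'. B \<in> C \<Longrightarrow> B' \<in> C \<Longrightarrow> emeasure M B \<le> emeasure M B' \<Longrightarrow> B \<subseteq> B'"
    and "\<And>t. t < emeasure M A \<Longrightarrow> \<exists>B\<in>C. emeasure M B = t"
proof -
  let ?\<mu> = "emeasure M"
  define X where "X = {B \<in> sets M. B \<subseteq> A \<and> ?\<mu> B < ?\<mu> A \<and> (?\<mu> B > 0 \<or> B = {})}"
  define P where "P = (\<lambda>B B'. B \<subseteq> B' \<and> ?\<mu> B < ?\<mu> B')"
  interpret pred_on X P .
  obtain C where C: "maxchain C" using Hausdorff by blast
  have cmp: "B = B' \<or> P B B' \<or> P B' B" if "B \<in> C" "B' \<in> C" for B B'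
    using C that unfolding maxchain_def chain_def by auto
  have CX: "C \<subseteq> X" using C unfolding maxchain_def chain_def by auto
  \<comment> \<open>Maximality in the form used throughout: a set comparable with the whole chain
    already lies in it.\<close>
  have ext: "D \<in> C" if D: "D \<in> X" "\<And>B. B \<in> C \<Longrightarrow> B = D \<or> P B D \<or> P D B" for D
  proof (rule ccontr)
    assume "D \<notin> C"
    moreover have "chain (insert D C)" unfolding chain_def using D cmp CX by auto
    ultimately show False using C unfolding maxchain_def by blast
  qed
  have mono: "B \<subseteq> B'" if "B \<in> C" "B' \<in> C" "?\<mu> B \<le> ?\<mu> B'" for B B'
    using cmp[OF that(1,2)] that(3) unfolding P_def by auto
  have Cfin: "?\<mu> B < \<infinity>" and CA: "B \<subseteq> A" and CS: "B \<in> sets M" and ClA: "?\<mu> B < ?\<mu> A" if "B \<in> C" for B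
    using that CX unfolding X_def by (auto intro: order.strict_trans2)
  have attained: "\<exists>B\<in>C. ?\<mu> B = t" if t: "t < ?\<mu> A" for t
  proof (rule ccontr)
    assume neg: "\<not> (\<exists>B\<in>C. ?\<mu> B = t)"
    have tfin: "t < \<infinity>" using t by (simp add: order.strict_trans2)
    have "{} \<in> C"
    proof (rule ext)
      show "{} \<in> X" unfolding X_def using t by (auto simp: zero_less_iff_neq_zero)
      show "B = {} \<or> P B {} \<or> P {} B" if "B \<in> C" for B
        using that CX unfolding X_def P_def by auto
    qed
    hence t0: "t > 0" using neg by (auto simp: zero_less_iff_neq_zero)
    define L where "L = {B \<in> C. ?\<mu> B < t}"
    have L0: "{} \<in> L" unfolding L_def using \<open>{} \<in> C\<close> t0 by auto
    define s where "s = Sup (?\<mu> ` L)"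
    have s_up: "?\<mu> B \<le> s" if "B \<in> L" for B unfolding s_def using that by (auto intro: SUP_upper)
    have st: "s \<le> t" unfolding s_def L_def by (auto intro!: SUP_least)
    \<comment> \<open>The supremum below \<open>t\<close> is attained: otherwise the union of an
      increasing sequence from \<open>L\<close> is comparable with the whole chain.\<close>
    have "\<exists>U\<in>C. ?\<mu> U = s"
    proof (cases "\<exists>U\<in>L. ?\<mu> U = s")
      case True thus ?thesis unfolding L_def by auto
    next
      case False
      hence slt: "?\<mu> B < s" if "B \<in> L" for B using that s_up[of B] by (auto simp: order.strict_iff_order)
      from ennreal_Sup_countable_SUP[of "?\<mu> ` L"] L0 obtain f :: "nat \<Rightarrow> ennreal"
        where f: "incseq f" "range f \<subseteq> ?\<mu> ` L" "s = (SUP n. f n)" unfolding s_def by auto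
      hence "\<forall>n. \<exists>B\<in>L. ?\<mu> B = f n" by (metis imageE range_subsetD)
      then obtain g where g: "\<And>n. g n \<in> L" "\<And>n. ?\<mu> (g n) = f n" by metis
      have gC: "g n \<in> C" for n using g(1) unfolding L_def by auto
      have inc: "incseq g" using f(1) g(2) mono gC by (auto simp: incseq_def)
      define U where "U = (\<Union>n. g n)"
      have mU: "?\<mu> U = s" unfolding U_def using SUP_emeasure_incseq[of g M] inc gC CS g(2) f(3) by (simp add: image_subset_iff)
      have "U \<in> C"
      proof (rule ext)
        show "U \<in> X" unfolding X_def using mU st t CS CA gC slt[OF L0] by (auto simp: U_def)
        show "B = U \<or> P B U \<or> P U B" if B: "B \<in> C" for B
        proof (cases "?\<mu> B < t")
          case True
          hence "?\<mu> B < s" using slt B unfolding L_def by auto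
          then obtain n where "?\<mu> B < f n" unfolding f(3) less_SUP_iff by auto
          hence "B \<subseteq> g n" using mono[OF B gC[of n]] g(2) by auto
          thus ?thesis using \<open>?\<mu> B < s\<close> mU unfolding P_def U_def by auto
        next
          case False
          hence Bt: "?\<mu> B > t" using neg B by (metis linorder_neqE)
          have "g n \<subseteq> B" for n
            using mono[OF gC B, of n] less_trans[of "?\<mu> (g n)" t "?\<mu> B"] g(1)[of n] Bt unfolding L_def by auto
          thus ?thesis using Bt st mU unfolding P_def U_def by auto
        qed
      qed
      thus ?thesis using mU by auto
    qed
    then obtain U where U: "U \<in> C" "?\<mu> U = s" by auto
    hence "s < t" using st neg by (auto simp: order.strict_iff_order)
    have below: "B \<subseteq> U" if "B \<in> C" "?\<mu> B < t" for B
      using mono[OF that(1) U(1)] s_up[of B] that U(2) unfolding L_def by auto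
    define R where "R = {B \<in> C. ?\<mu> B > t}"
    show False
    proof (cases "R = {}")
      case True
      \<comment> \<open>No member lies above \<open>t\<close>, so the gap is \<open>A - U\<close>. A
        finite piece \<open>D\<close> of it is split and only \<open>D'\<close> is added, which
        leaves the measure strictly below that of \<open>A\<close>; the new member then contradicts
        the choice of \<open>s\<close>.\<close>
      have "?\<mu> (A - U) > 0"
        using emeasure_Diff[of M U A] CS[OF U(1)] Cfin[OF U(1)] A CA[OF U(1)] U(2) t \<open>s < t\<close>
        by (metis diff_gt_0_iff_gt_ennreal order.strict_trans infinity_ennreal_def less_irrefl)
      moreover have AU: "A - U \<in> sets M" using A CS[OF U(1)] by auto
      ultimately obtain D where D: "D \<in> sets M" "D \<subseteq> A - U" "?\<mu> D > 0" "?\<mu> D < \<infinity>"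
        using finite_positive_subset by blast
      then obtain D' where D': "D' \<in> sets M" "D' \<subseteq> D" "?\<mu> D' > 0" "?\<mu> (D - D') > 0"
        using split_positive by blast
      have "U \<inter> D' = {}" using D'(2) D(2) by auto
      have mD: "?\<mu> (U \<union> D') = s + ?\<mu> D'"
        using plus_emeasure[OF CS[OF U(1)] D'(1)] \<open>U \<inter> D' = {}\<close> U(2) by simp
      have D'fin: "?\<mu> D' < \<infinity>" using D'(2) D(1,4) emeasure_mono le_less_trans by blast
      have sfin: "s < \<infinity>" using \<open>s < t\<close> tfin by auto
      have "U \<union> D' \<in> C"
      proof (rule ext)
        have "(U \<union> D') \<inter> (D - D') = {}" using D(2) by auto
        have "s + ?\<mu> D' < s + ?\<mu> D' + ?\<mu> (D - D')"
          by (rule ennreal_less_add_right) (use D'fin sfin D'(4) in auto)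
        also have "\<dots> = ?\<mu> (U \<union> D' \<union> (D - D'))"
          using plus_emeasure[of "U \<union> D'" M "D - D'"] CS[OF U(1)] D'(1) D(1) \<open>(U \<union> D') \<inter> (D - D') = {}\<close>
          by (simp add: mD)
        also have "\<dots> \<le> ?\<mu> A" by (rule emeasure_mono) (use D D' CA[OF U(1)] A in auto)
        finally have "?\<mu> (U \<union> D') < ?\<mu> A" unfolding mD .
        thus "U \<union> D' \<in> X" unfolding X_def using mD D' D CS[OF U(1)] CA[OF U(1)] by auto
        show "B = U \<union> D' \<or> P B (U \<union> D') \<or> P (U \<union> D') B" if B: "B \<in> C" for B
        proof -
          have "?\<mu> B < t" using True B neg unfolding R_def by (metis (lifting) empty_iff linorder_neqE mem_Collect_eq)
          hence "B \<subseteq> U" "?\<mu> B \<le> s" using below B s_up unfolding L_def by auto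
          moreover have "s < s + ?\<mu> D'" by (rule ennreal_less_add_right) (use sfin D' in auto)
          ultimately show ?thesis unfolding P_def mD using le_less_trans by blast
        qed
      qed
      moreover have "?\<mu> (U \<union> D') > s" unfolding mD by (rule ennreal_less_add_right) (use sfin D' in auto)
      moreover have "?\<mu> (U \<union> D') < t"
        using True calculation(1) neg unfolding R_def by (metis (lifting) empty_iff linorder_neqE mem_Collect_eq)
      ultimately show False using s_up[of "U \<union> D'"] unfolding L_def by auto
    next
      case False
      define i where "i = Inf (?\<mu> ` R)"
      have i_low: "i \<le> ?\<mu> B" if "B \<in> R" for B unfolding i_def using that by (auto intro: INF_lower)
      have ti: "t \<le> i" unfolding i_def R_def by (auto intro!: INF_greatest)
      \<comment> \<open>Dually, the infimum above \<open>t\<close> is attained, if necessary by a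
        decreasing intersection; continuity from above applies because members have finite
        measure.\<close>
      have "\<exists>V\<in>C. ?\<mu> V = i"
      proof (cases "\<exists>V\<in>R. ?\<mu> V = i")
        case True thus ?thesis unfolding R_def by auto
      next
        case nat: False
        hence ilt: "i < ?\<mu> B" if "B \<in> R" for B using that i_low[of B] by (metis order.strict_iff_order)
        from ennreal_Inf_countable_INF[of "?\<mu> ` R"] False obtain f :: "nat \<Rightarrow> ennreal"
          where f: "decseq f" "range f \<subseteq> ?\<mu> ` R" "i = (INF n. f n)" unfolding i_def by auto
        hence "\<forall>n. \<exists>B\<in>R. ?\<mu> B = f n" by (metis imageE range_subsetD)
        then obtain g where g: "\<And>n. g n \<in> R" "\<And>n. ?\<mu> (g n) = f n" by metis
        have gC: "g n \<in> C" for n using g(1) unfolding R_def by auto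
        have dec: "decseq g" using f(1) g(2) mono gC by (auto simp: decseq_def)
        define V where "V = (\<Inter>n. g n)"
        have gfin: "?\<mu> (g n) \<noteq> \<infinity>" for n using Cfin[OF gC[of n]] by simp
        have mV: "?\<mu> V = i" unfolding V_def
          using INF_emeasure_decseq[of g M, OF _ dec gfin] gC CS g(2) f(3) by (simp add: image_subset_iff)
        have "V \<in> C"
        proof (rule ext)
          have "V \<in> sets M" unfolding V_def using gC CS by auto
          moreover have "V \<subseteq> A" unfolding V_def using CA[OF gC[of 0]] by auto
          moreover have "i < ?\<mu> A" using ilt[OF g(1)[of 0]] ClA[OF gC[of 0]] by order
          moreover have "i > 0" using ti t0 by order
          ultimately show "V \<in> X" unfolding X_def using mV by auto
          show "B = V \<or> P B V \<or> P V B" if B: "B \<in> C" for B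
          proof (cases "?\<mu> B < t")
            case True
            have "B \<subseteq> g n" for n
              using mono[OF B gC, of n] less_trans[of "?\<mu> B" t "?\<mu> (g n)"] g(1)[of n] True unfolding R_def by auto
            thus ?thesis using True ti mV unfolding P_def V_def by auto
          next
            case False
            hence "B \<in> R" using neg B unfolding R_def by (metis (lifting) linorder_neqE mem_Collect_eq)
            hence "?\<mu> B > i" using ilt by auto
            then obtain n where "f n < ?\<mu> B" unfolding f(3) INF_less_iff by auto
            hence "g n \<subseteq> B" using mono[OF gC[of n] B] g(2) by auto
            thus ?thesis using \<open>?\<mu> B > i\<close> mV unfolding P_def V_def by auto
          qed
        qed
        thus ?thesis using mV by auto
      qed
      then obtain V where V: "V \<in> C" "?\<mu> V = i" by auto
      hence "t < i" using ti neg by (auto simp: order.strict_iff_order)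
      hence si: "s < i" using \<open>s < t\<close> by order
      hence UV: "U \<subseteq> V" using mono[OF U(1) V(1)] U V by auto
      have above: "V \<subseteq> B" "i \<le> ?\<mu> B" if "B \<in> C" "\<not> ?\<mu> B < t" for B
      proof -
        have "B \<in> R" using neg that unfolding R_def by (metis (lifting) linorder_neqE mem_Collect_eq)
        thus "i \<le> ?\<mu> B" by (rule i_low)
        thus "V \<subseteq> B" using mono[OF V(1) that(1)] V(2) by auto
      qed
      \<comment> \<open>Adding one part of a split of \<open>V - U\<close> to \<open>U\<close> gives
        a chain member of measure strictly between \<open>s\<close> and \<open>i\<close>, where no
        member can be.\<close>
      have "?\<mu> (V - U) > 0"
        using emeasure_Diff[of M U V] CS Cfin U V UV si
        by (metis diff_gt_0_iff_gt_ennreal infinity_ennreal_def less_irrefl)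
      moreover have VU: "V - U \<in> sets M" using CS U V by auto
      ultimately obtain B where B: "B \<in> sets M" "B \<subseteq> V - U" "?\<mu> B > 0" "?\<mu> (V - U - B) > 0"
        using split_positive by blast
      have sfin: "s < \<infinity>" using \<open>s < t\<close> tfin by auto
      have "U \<inter> B = {}" using B(2) by auto
      have mD: "?\<mu> (U \<union> B) = s + ?\<mu> B"
        using plus_emeasure[OF CS[OF U(1)] B(1)] \<open>U \<inter> B = {}\<close> U(2) by simp
      have Bfin: "?\<mu> B < \<infinity>"
        using B(2) Cfin[OF V(1)] emeasure_mono[of B V M] CS[OF V(1)] by (auto intro: le_less_trans)
      have Ds: "s < ?\<mu> (U \<union> B)" unfolding mD by (rule ennreal_less_add_right) (use sfin B in auto)
      have Di: "?\<mu> (U \<union> B) < i"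
      proof -
        have "(U \<union> B) \<inter> (V - U - B) = {}" by auto
        have "s + ?\<mu> B < s + ?\<mu> B + ?\<mu> (V - U - B)"
          by (rule ennreal_less_add_right) (use Bfin sfin B(4) in auto)
        also have "\<dots> = ?\<mu> (U \<union> B \<union> (V - U - B))"
          using plus_emeasure[of "U \<union> B" M "V - U - B"] CS[OF U(1)] VU B(1) \<open>(U \<union> B) \<inter> (V - U - B) = {}\<close>
          by (simp add: mD)
        also have "U \<union> B \<union> (V - U - B) = V" using UV B by auto
        finally show ?thesis using mD V(2) by simp
      qed
      have "U \<union> B \<in> C"
      proof (rule ext)
        show "U \<union> B \<in> X" unfolding X_def
          using Di ClA[OF V(1)] V(2) CS[OF U(1)] B CA[OF V(1)] UV Ds by auto
        show "B' = U \<union> B \<or> P B' (U \<union> B) \<or> P (U \<union> B) B'" if B': "B' \<in> C" for B'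
        proof (cases "?\<mu> B' < t")
          case True
          hence "B' \<subseteq> U" "?\<mu> B' \<le> s" using below B' s_up unfolding L_def by auto
          thus ?thesis unfolding P_def using Ds by auto
        next
          case False
          from above[OF B' this] show ?thesis unfolding P_def using Di UV B(2) by auto
        qed
      qed
      thus False using Ds Di s_up[of "U \<union> B"] above(2)[of "U \<union> B"] unfolding L_def by fastforce
    qed
  qed
  show ?thesis by (rule that[of C]) (use CS CA ClA mono attained in auto)
qed

text \<open>Up to a null set, \<open>\<phi>\<close> is the infimum of the measures of the chain
  members containing a point, so its sublevel sets are unions of chain members. Positivity keeps
  transferred functions finite; the value infinity off \<open>A\<close> makes them vanish
  there.\<close>

lemma uniform_fun_exists:
  assumes A: "A \<in> sets M"
  obtains \<phi> :: "'a \<Rightarrow> ennreal" where "\<phi> \<in> borel_measurable M" "\<And>\<omega>. \<phi> \<omega> > 0"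
    "\<And>\<omega>. \<omega> \<notin> A \<Longrightarrow> \<phi> \<omega> = \<infinity>"
    "\<And>t. emeasure M {\<omega> \<in> space M. \<phi> \<omega> < t} = min t (emeasure M A)"
proof -
  let ?\<mu> = "emeasure M"
  obtain C where C: "C \<subseteq> {B \<in> sets M. B \<subseteq> A \<and> ?\<mu> B < ?\<mu> A}"
    and mono: "\<And>B B'. B \<in> C \<Longrightarrow> B' \<in> C \<Longrightarrow> ?\<mu> B \<le> ?\<mu> B' \<Longrightarrow> B \<subseteq> B'"
    and att: "\<And>t. t < ?\<mu> A \<Longrightarrow> \<exists>B\<in>C. ?\<mu> B = t"
    by (rule chain_of_all_measures[OF A]) blast
  define \<psi> where "\<psi> \<omega> = Inf {?\<mu> B | B. B \<in> C \<and> \<omega> \<in> B}" for \<omega>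
  have lt: "{\<omega> \<in> space M. \<psi> \<omega> < t} = \<Union>{B \<in> C. ?\<mu> B < t}" for t
    unfolding \<psi>_def Inf_less_iff using C sets.sets_into_space by auto
  have level: "{\<omega> \<in> space M. \<psi> \<omega> < t} \<in> sets M \<and> ?\<mu> {\<omega> \<in> space M. \<psi> \<omega> < t} = min t (?\<mu> A)" for t
  proof -
    define T where "T = min t (?\<mu> A)"
    have same: "{B \<in> C. ?\<mu> B < t} = {B \<in> C. ?\<mu> B < T}" unfolding T_def using C by auto
    show ?thesis
    proof (cases "T = 0")
      case True
      thus ?thesis unfolding lt same T_def[symmetric] by simp
    next
      case False
      have "0 \<in> {..<T}" using False by (auto simp: zero_less_iff_neq_zero)
      hence "{..<T} \<noteq> {}" by blast
      moreover have "Sup {..<T} = T" by (rule Sup_lessThan)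
      ultimately obtain f :: "nat \<Rightarrow> ennreal" where f: "incseq f" "range f \<subseteq> {..<T}" "T = (SUP n. f n)"
        using ennreal_Sup_countable_SUP[of "{..<T}"] by auto
      have "\<exists>B\<in>C. ?\<mu> B = f n" for n using range_subsetD[OF f(2), of n] att[of "f n"] unfolding T_def by simp
      then obtain g where g: "\<And>n. g n \<in> C" "\<And>n. ?\<mu> (g n) = f n" by metis
      have inc: "incseq g" using f(1) g mono by (auto simp: incseq_def)
      \<comment> \<open>The chain is ordered by measure, so countably many members with measures
        increasing to \<open>T\<close> exhaust the possibly uncountable union.\<close>
      have "\<Union>{B \<in> C. ?\<mu> B < T} = (\<Union>n. g n)"
      proof
        show "\<Union>{B \<in> C. ?\<mu> B < T} \<subseteq> (\<Union>n. g n)"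
        proof safe
          fix \<omega> B assume *: "B \<in> C" "?\<mu> B < T" "\<omega> \<in> B"
          then obtain n where "?\<mu> B < f n" unfolding f(3) less_SUP_iff by auto
          hence "B \<subseteq> g n" using mono * g by auto
          thus "\<omega> \<in> (\<Union>n. g n)" using * by auto
        qed
        have "g n \<in> {B \<in> C. ?\<mu> B < T}" for n using g range_subsetD[OF f(2), of n] by simp
        thus "(\<Union>n. g n) \<subseteq> \<Union>{B \<in> C. ?\<mu> B < T}" by blast
      qed
      moreover have gs: "g n \<in> sets M" for n using g C by auto
      moreover have "?\<mu> (\<Union>n. g n) = T" using SUP_emeasure_incseq[of g M] inc gs g f(3) by (simp add: image_subset_iff)
      ultimately show ?thesis unfolding lt same T_def[symmetric] by auto
    qed
  qed
  have \<psi>m: "\<psi> \<in> borel_measurable M" by (rule borel_measurableI_less) (use level in auto)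
  have null: "{\<omega> \<in> space M. \<psi> \<omega> = 0} \<in> null_sets M"
  proof -
    have "?\<mu> {\<omega> \<in> space M. \<psi> \<omega> = 0} \<le> e" if "e > 0" for e
    proof -
      have "?\<mu> {\<omega> \<in> space M. \<psi> \<omega> = 0} \<le> ?\<mu> {\<omega> \<in> space M. \<psi> \<omega> < e}"
        by (rule emeasure_mono) (use level that in auto)
      thus ?thesis using level[of e] by simp
    qed
    hence "?\<mu> {\<omega> \<in> space M. \<psi> \<omega> = 0} \<le> 0" by (rule dense_ge) auto
    moreover have "{\<omega> \<in> space M. \<psi> \<omega> = 0} \<in> sets M" using \<psi>m by measurable
    ultimately show ?thesis by auto
  qed
  \<comment> \<open>The value 0 occurs only on a null set and is replaced by infinity to get strict
    positivity everywhere.\<close>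
  define \<phi> where "\<phi> \<omega> = (if \<psi> \<omega> = 0 then \<infinity> else \<psi> \<omega>)" for \<omega>
  show ?thesis
  proof (rule that)
    show "\<phi> \<in> borel_measurable M" unfolding \<phi>_def using \<psi>m by measurable
    show "\<phi> \<omega> > 0" for \<omega> unfolding \<phi>_def by (auto simp: zero_less_iff_neq_zero)
    show "\<phi> \<omega> = \<infinity>" if "\<omega> \<notin> A" for \<omega>
    proof -
      have "{?\<mu> B | B. B \<in> C \<and> \<omega> \<in> B} = {}" using C that by auto
      hence "\<psi> \<omega> = \<infinity>" unfolding \<psi>_def by (simp only: Inf_empty infinity_ennreal_def)
      thus ?thesis unfolding \<phi>_def by simp
    qed
    show "?\<mu> {\<omega> \<in> space M. \<phi> \<omega> < t} = min t (?\<mu> A)" for t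
    proof -
      have "{\<omega> \<in> space M. \<phi> \<omega> < t} = {\<omega> \<in> space M. \<psi> \<omega> < t} - {\<omega> \<in> space M. \<psi> \<omega> = 0}"
        unfolding \<phi>_def by auto
      thus ?thesis using emeasure_Diff_null_set[OF null] level by auto
    qed
  qed
qed

text \<open>The sets are built from layers between consecutive levels of a uniformly distributed
  function. With infinite total measure every \<open>A k\<close> is given infinite measure, so that
  infinite \<open>p k\<close> are covered too.\<close>

lemma disjoint_sets_of_given_measures:
  assumes p: "(\<Sum>k. p k) \<le> emeasure M (space M)"
  obtains A :: "nat \<Rightarrow> 'a set" where "disjoint_family A" "\<And>k. A k \<in> sets M" "\<And>k. p k \<le> emeasure M (A k)"
proof -
  obtain \<phi> :: "'a \<Rightarrow> ennreal" where \<phi>: "\<phi> \<in> borel_measurable M"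
    and \<phi>_lt: "\<And>t. emeasure M {\<omega> \<in> space M. \<phi> \<omega> < t} = min t (emeasure M (space M))"
    using uniform_fun_exists[OF sets.top] by metis
  have level: "{\<omega> \<in> space M. \<phi> \<omega> < t} \<in> sets M" for t using \<phi> by measurable
  define B where "B s n = {\<omega> \<in> space M. \<phi> \<omega> < s (Suc n)} - {\<omega> \<in> space M. \<phi> \<omega> < s n}"
    for s :: "nat \<Rightarrow> ennreal" and n
  have B_sets: "B s n \<in> sets M" for s n unfolding B_def using level by auto
  have B_disj: "disjoint_family (B s)" if "incseq s" for s unfolding B_def
    by (rule disjoint_family_Suc) (use that in \<open>auto simp: incseq_Suc_iff intro: order.strict_trans2\<close>)
  have B_meas: "emeasure M (B s n) = s (Suc n) - s n"
    if "incseq s" "s (Suc n) \<le> emeasure M (space M)" "s n < \<infinity>" for s n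
  proof -
    have "s n \<le> s (Suc n)" using that by (simp add: incseq_SucD)
    hence "s n \<le> emeasure M (space M)" using that by order
    moreover have "emeasure M (B s n) = emeasure M {\<omega> \<in> space M. \<phi> \<omega> < s (Suc n)} - emeasure M {\<omega> \<in> space M. \<phi> \<omega> < s n}"
      unfolding B_def using \<open>s n \<le> s (Suc n)\<close> that(3) calculation
      by (intro emeasure_Diff level) (auto simp: \<phi>_lt min_def)
    ultimately show ?thesis using that(2) by (simp add: \<phi>_lt min_absorb1)
  qed
  show ?thesis
  proof (cases "emeasure M (space M) = \<infinity>")
    case True
    define s :: "nat \<Rightarrow> ennreal" where "s n = of_nat n" for n
    have inc: "incseq s" unfolding s_def by (auto simp: incseq_def)
    have one: "emeasure M (B s n) = 1" for n
      using B_meas[OF inc, of n] True unfolding s_def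
      by (simp add: ennreal_of_nat_eq_real_of_nat ennreal_minus flip: ennreal_1 ennreal_plus)
    \<comment> \<open>The pairing function gives each \<open>k\<close> infinitely many of the unit
      layers, so every \<open>A k\<close> has infinite measure.\<close>
    define A where "A k = (\<Union>j. B s (prod_encode (k, j)))" for k
    have "disjoint_family A"
      using B_disj[OF inc] unfolding A_def disjoint_family_on_def by (auto, metis (no_types) Int_iff Pair_inject empty_iff prod_encode_eq)
    moreover have "emeasure M (A k) = \<infinity>" for k
    proof -
      have "disjoint_family (\<lambda>j. B s (prod_encode (k, j)))"
        using B_disj[OF inc] unfolding disjoint_family_on_def by auto
      hence "emeasure M (A k) = (\<Sum>j. emeasure M (B s (prod_encode (k, j))))"
        unfolding A_def using B_sets by (intro suminf_emeasure[symmetric]) auto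
      also have "\<dots> = (SUP n. of_nat n)" unfolding one by (simp add: suminf_eq_SUP)
      also have "\<dots> = \<infinity>" by (simp add: ennreal_SUP_of_nat_eq_top)
      finally show ?thesis .
    qed
    ultimately show ?thesis using that[of A] B_sets unfolding A_def by auto
  next
    case False
    \<comment> \<open>Cutting at the partial sums gives layer \<open>n\<close> measure exactly
      \<open>p n\<close>; the levels are finite since the total measure is.\<close>
    define s where "s n = (\<Sum>j<n. p j)" for n
    have inc: "incseq s" unfolding s_def by (auto simp: incseq_Suc_iff)
    have le: "s n \<le> emeasure M (space M)" for n
      using sum_le_suminf[of p "{..<n}"] p unfolding s_def by (auto intro: order.trans)
    hence fin: "s n < \<infinity>" for n using False by (metis infinity_ennreal_def le_less_trans less_top)
    have "emeasure M (B s n) = p n" for n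
      using B_meas[OF inc le fin, of n] fin[of n] unfolding s_def by (simp add: ennreal_add_diff_cancel_left less_top)
    thus ?thesis using that[of "B s"] B_disj[OF inc] B_sets by auto
  qed
qed

end

section \<open>Distribution functions\<close>

lemma distribution_fun_apply:
  "0 \<le> y \<Longrightarrow> distribution_fun M f y = emeasure M {\<omega> \<in> space M. \<bar>f \<omega>\<bar> > y}"
  by (simp add: distribution_fun_def)

lemma distribution_fun_eqI:
  assumes "\<And>y. 0 \<le> y \<Longrightarrow> distribution_fun M f y = distribution_fun M' g y"
  shows "distribution_fun M f = distribution_fun M' g"
proof
  fix y show "distribution_fun M f y = distribution_fun M' g y"
    using assms[of y] by (cases "0 \<le> y") (auto simp: distribution_fun_def restrict_def)
qed

lemma distribution_fun_le_total: "distribution_fun M f 0 \<le> emeasure M (space M)"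
  unfolding distribution_fun_apply[OF order.refl] by (rule emeasure_space)

lemma distribution_fun_mono:
  assumes "g \<in> borel_measurable M" "AE \<omega> in M. \<bar>f \<omega>\<bar> \<le> \<bar>g \<omega>\<bar>" "0 \<le> y"
  shows "distribution_fun M f y \<le> distribution_fun M g y"
  unfolding distribution_fun_apply[OF assms(3)]
  by (rule emeasure_mono_AE) (use assms in \<open>auto elim!: eventually_mono\<close>)

lemma distribution_fun_antimono:
  assumes "f \<in> borel_measurable M" "0 \<le> x" "x \<le> y"
  shows "distribution_fun M f y \<le> distribution_fun M f x"
  using assms by (auto simp: distribution_fun_apply intro!: emeasure_mono)

text \<open>Continuity from below: the sets \<open>{|f| > y + 1/(n+1)}\<close> increase to
  \<open>{|f| > y}\<close>, so a bound exceeded at \<open>y\<close> is exceeded at some larger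
  level.\<close>

lemma distribution_fun_right_continuous:
  assumes f: "f \<in> borel_measurable M" and "0 \<le> y" "x < distribution_fun M f y"
  obtains z where "z > y" "x < distribution_fun M f z"
proof -
  define S where "S n = {\<omega> \<in> space M. \<bar>f \<omega>\<bar> > y + 1 / Suc n}" for n
  have inc: "incseq S" unfolding incseq_def
  proof safe
    fix m n :: nat and \<omega> assume "m \<le> n" "\<omega> \<in> S m"
    moreover have "1 / real (Suc n) \<le> 1 / real (Suc m)" using \<open>m \<le> n\<close> by (intro divide_left_mono) auto
    ultimately show "\<omega> \<in> S n" unfolding S_def by simp
  qed
  have Ss: "range S \<subseteq> sets M" using f unfolding S_def by auto
  have "{\<omega> \<in> space M. \<bar>f \<omega>\<bar> > y} = (\<Union>n. S n)"
  proof
    show "{\<omega> \<in> space M. \<bar>f \<omega>\<bar> > y} \<subseteq> (\<Union>n. S n)"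
    proof safe
      fix \<omega> assume "\<omega> \<in> space M" "\<bar>f \<omega>\<bar> > y"
      moreover then obtain n where "inverse (real (Suc n)) < \<bar>f \<omega>\<bar> - y"
        using reals_Archimedean[of "\<bar>f \<omega>\<bar> - y"] by auto
      ultimately have "\<omega> \<in> S n" unfolding S_def by (auto simp: field_simps)
      thus "\<omega> \<in> (\<Union>n. S n)" by blast
    qed
    have "y < y + 1 / real (Suc n)" for n by simp
    thus "(\<Union>n. S n) \<subseteq> {\<omega> \<in> space M. \<bar>f \<omega>\<bar> > y}" unfolding S_def
      using less_trans by blast
  qed
  moreover have "(SUP n. emeasure M (S n)) = emeasure M (\<Union>n. S n)"
    by (rule SUP_emeasure_incseq) (use inc Ss in auto)
  ultimately have "x < (SUP n. emeasure M (S n))" using assms by (simp add: distribution_fun_apply)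
  then obtain n where "x < emeasure M (S n)" unfolding less_SUP_iff by auto
  thus ?thesis using that[of "y + 1 / Suc n"] \<open>0 \<le> y\<close> by (simp add: S_def distribution_fun_apply)
qed

text \<open>The rearrangement is the generalized inverse of the distribution function. Right
  continuity turns strict inequality into an equivalence: it yields a level \<open>z > y\<close>
  below which nothing enters the infimum.\<close>

lemma decr_rearrangement_greater_iff:
  assumes f: "f \<in> borel_measurable M" and "0 \<le> x" "0 \<le> y"
  shows "ennreal y < decr_rearrangement M f x \<longleftrightarrow> ennreal x < distribution_fun M f y"
proof -
  let ?S = "{ennreal y | y. y \<ge> 0 \<and> distribution_fun M f y \<le> ennreal x}"
  have eq: "decr_rearrangement M f x = Inf ?S" using assms by (simp add: decr_rearrangement_def)
  show ?thesis
  proof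
    assume *: "ennreal y < decr_rearrangement M f x"
    show "ennreal x < distribution_fun M f y"
    proof (rule ccontr)
      assume "\<not> ?thesis"
      hence "ennreal y \<in> ?S" using assms by auto
      hence "Inf ?S \<le> ennreal y" by (rule Inf_lower)
      thus False using * eq by simp
    qed
  next
    assume "ennreal x < distribution_fun M f y"
    then obtain z where z: "z > y" "ennreal x < distribution_fun M f z"
      using distribution_fun_right_continuous[OF f \<open>0 \<le> y\<close>] by metis
    have "ennreal z \<le> Inf ?S"
    proof (rule Inf_greatest)
      fix w assume "w \<in> ?S"
      then obtain v where v: "w = ennreal v" "v \<ge> 0" "distribution_fun M f v \<le> ennreal x" by auto
      have "z \<le> v"
      proof (rule ccontr)
        assume "\<not> z \<le> v"
        hence "distribution_fun M f z \<le> distribution_fun M f v" using v by (intro distribution_fun_antimono[OF f]) auto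
        thus False using v z by (meson leD order.trans)
      qed
      thus "ennreal z \<le> w" using v by (simp add: ennreal_leI)
    qed
    moreover have "ennreal y < ennreal z" using z assms by (simp add: ennreal_less_iff)
    ultimately show "ennreal y < decr_rearrangement M f x" unfolding eq by (rule less_le_trans[rotated])
  qed
qed

text \<open>Real thresholds suffice because the smaller of two distinct values is finite and serves
  as the threshold itself.\<close>

lemma ennreal_eqI_less:
  assumes "\<And>x. 0 \<le> x \<Longrightarrow> ennreal x < a \<longleftrightarrow> ennreal x < b"
  shows "a = b"
proof (rule ccontr)
  assume "a \<noteq> b"
  then consider "a < b" | "b < a" by (meson linorder_neqE)
  thus False
  proof cases
    case 1
    hence "a < top" by (rule order.strict_trans2) simp
    thus False using assms[of "enn2real a"] 1 by simp
  next
    case 2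
    hence "b < top" by (rule order.strict_trans2) simp
    thus False using assms[of "enn2real b"] 2 by simp
  qed
qed

text \<open>The threshold equivalence recovers the distribution function from the rearrangement, and
  the converse is immediate from the definition. Equimeasurability can thus be handled through
  distribution functions.\<close>

lemma decr_rearrangement_eq_iff:
  assumes "f \<in> borel_measurable M" "g \<in> borel_measurable M'"
  shows "decr_rearrangement M f = decr_rearrangement M' g \<longleftrightarrow> distribution_fun M f = distribution_fun M' g"
proof
  assume *: "decr_rearrangement M f = decr_rearrangement M' g"
  show "distribution_fun M f = distribution_fun M' g"
  proof (rule distribution_fun_eqI, rule ennreal_eqI_less)
    fix x y :: real assume "0 \<le> x" "0 \<le> y"
    thus "ennreal x < distribution_fun M f y \<longleftrightarrow> ennreal x < distribution_fun M' g y"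
      using decr_rearrangement_greater_iff[OF assms(1), of x y] decr_rearrangement_greater_iff[OF assms(2), of x y]
      by (simp add: *)
  qed
qed (simp add: decr_rearrangement_def)

lemma distribution_fun_zero_iff:
  assumes "f \<in> borel_measurable M"
  shows "distribution_fun M f 0 = 0 \<longleftrightarrow> (AE \<omega> in M. f \<omega> = 0)"
proof -
  have "{\<omega> \<in> space M. \<bar>f \<omega>\<bar> > 0} \<in> sets M" using assms by measurable
  from AE_iff_measurable[OF this, of "\<lambda>\<omega>. f \<omega> = 0"] show ?thesis
    unfolding distribution_fun_apply[OF order.refl] by simp
qed

lemma distribution_fun_scale:
  assumes "0 \<le> y"
  shows "distribution_fun M (\<lambda>\<omega>. c * f \<omega>) y = (if c = 0 then 0 else distribution_fun M f (y / \<bar>c\<bar>))"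
proof (cases "c = 0")
  case False
  hence "y < \<bar>c * f \<omega>\<bar> \<longleftrightarrow> y / \<bar>c\<bar> < \<bar>f \<omega>\<bar>" for \<omega>
    by (simp add: abs_mult pos_divide_less_eq mult.commute)
  thus ?thesis using False assms by (simp add: distribution_fun_apply)
qed (use assms in \<open>simp add: distribution_fun_apply\<close>)

lemma distribution_fun_scale_cong:
  assumes "distribution_fun M f = distribution_fun M' g"
  shows "distribution_fun M (\<lambda>\<omega>. c * f \<omega>) = distribution_fun M' (\<lambda>\<omega>. c * g \<omega>)"
  by (rule distribution_fun_eqI) (simp add: distribution_fun_scale assms)

section \<open>Realising a given distribution function on a nonatomic space\<close>

lemma distribution_fun_tends_to_zero:
  assumes f: "f \<in> borel_measurable M" and "0 \<le> y" "distribution_fun M f y < \<infinity>" and e: "e > 0"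
  obtains z where "0 \<le> z" "distribution_fun M f z < e"
proof -
  define S where "S n = {\<omega> \<in> space M. \<bar>f \<omega>\<bar> > y + real n}" for n
  have dec: "decseq S" unfolding decseq_def S_def by (auto intro: order.strict_trans1)
  have Ss: "range S \<subseteq> sets M" using f unfolding S_def by auto
  have Sf: "emeasure M (S n) \<noteq> \<infinity>" for n
  proof -
    have "emeasure M (S n) \<le> distribution_fun M f y" unfolding S_def distribution_fun_apply[OF assms(2)]
      using f by (intro emeasure_mono) auto
    thus ?thesis using assms(3) by (auto simp: top_unique)
  qed
  \<comment> \<open>Values are real, so no point lies above all levels; the finite level
    \<open>y\<close> permits continuity from above.\<close>
  have "(\<Inter>n. S n) = {}"
  proof -
    have "\<exists>n. \<omega> \<notin> S n" for \<omega>
      using reals_Archimedean2[of "\<bar>f \<omega>\<bar> - y"] unfolding S_def by (auto simp: not_less) (metis add.commute diff_le_eq less_imp_le)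
    thus ?thesis by auto
  qed
  moreover have "(INF n. emeasure M (S n)) = emeasure M (\<Inter>n. S n)"
    by (rule INF_emeasure_decseq) (use dec Ss Sf in auto)
  ultimately have "(INF n. emeasure M (S n)) < e" using e by simp
  then obtain n where "emeasure M (S n) < e" unfolding INF_less_iff by auto
  thus ?thesis using that[of "y + real n"] assms(2) by (simp add: S_def distribution_fun_apply)
qed

text \<open>For a distribution function \<open>\<eta>\<close> this is its generalized inverse, the
  decreasing rearrangement, evaluated at \<open>\<phi> \<omega>\<close>. Inserting 0 fixes the value
  when no level qualifies.\<close>

definition transfer :: "('a \<Rightarrow> ennreal) \<Rightarrow> (real \<Rightarrow> ennreal) \<Rightarrow> 'a \<Rightarrow> real" where
  "transfer \<phi> \<eta> \<omega> = Sup (insert 0 {y. 0 \<le> y \<and> \<phi> \<omega> < \<eta> y})"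

text \<open>The distribution function tends to 0 and \<open>p\<close> is positive, so large levels
  drop out and the real supremum is meaningful.\<close>

lemma transfer_bdd_above:
  assumes g: "g \<in> borel_measurable M" and fin: "0 \<le> y0" "distribution_fun M g y0 < \<infinity>" and pos: "p > 0"
  shows "bdd_above (insert 0 {y. 0 \<le> y \<and> p < distribution_fun M g y})"
proof -
  obtain z where z: "0 \<le> z" "distribution_fun M g z < p"
    using distribution_fun_tends_to_zero[OF g fin pos] by metis
  have "x \<le> z" if "x \<in> insert 0 {y. 0 \<le> y \<and> p < distribution_fun M g y}" for x
    using that z distribution_fun_antimono[OF g z(1), of x] by (fastforce dest: order.strict_trans1)
  thus ?thesis by (rule bdd_aboveI)
qed

text \<open>By right continuity the set where the transferred function exceeds \<open>y\<close> is a
  sublevel set of \<open>\<phi>\<close>, whose measure is known when \<open>\<phi>\<close> is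
  uniformly distributed.\<close>

lemma transfer_greater_iff:
  assumes g: "g \<in> borel_measurable M" and fin: "0 \<le> y0" "distribution_fun M g y0 < \<infinity>"
    and pos: "\<phi> \<omega> > 0" and y: "0 \<le> y"
  shows "transfer \<phi> (distribution_fun M g) \<omega> > y \<longleftrightarrow> \<phi> \<omega> < distribution_fun M g y"
proof -
  let ?S = "insert 0 {y. 0 \<le> y \<and> \<phi> \<omega> < distribution_fun M g y}"
  note bdd = transfer_bdd_above[OF g fin pos]
  have "transfer \<phi> (distribution_fun M g) \<omega> > y \<longleftrightarrow> (\<exists>x\<in>?S. y < x)"
    unfolding transfer_def by (rule less_cSup_iff) (use bdd in auto)
  also have "\<dots> \<longleftrightarrow> \<phi> \<omega> < distribution_fun M g y"
  proof
    assume "\<exists>x\<in>?S. y < x"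
    then obtain x where "\<phi> \<omega> < distribution_fun M g x" "y < x" using y by auto
    thus "\<phi> \<omega> < distribution_fun M g y" using distribution_fun_antimono[OF g y, of x] by auto
  next
    assume "\<phi> \<omega> < distribution_fun M g y"
    then obtain x where "x > y" "\<phi> \<omega> < distribution_fun M g x" using distribution_fun_right_continuous[OF g y] by metis
    thus "\<exists>x\<in>?S. y < x" using y by (intro bexI[of _ x]) auto
  qed
  finally show ?thesis .
qed

lemma transfer_nonneg:
  assumes g: "g \<in> borel_measurable M" and fin: "0 \<le> y0" "distribution_fun M g y0 < \<infinity>" and pos: "\<phi> \<omega> > 0"
  shows "transfer \<phi> (distribution_fun M g) \<omega> \<ge> 0"
  unfolding transfer_def by (rule cSup_upper[OF _ transfer_bdd_above[OF assms]]) simp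

context nonatomic_measure_space
begin

text \<open>One operator built from one \<open>\<phi>\<close> serves all functions at once. As it
  depends on \<open>g\<close> only through the distribution function, domination almost everywhere
  becomes domination at every point. The bound at level 0 makes the truncation
  \<open>min t (emeasure M A)\<close> harmless.\<close>

lemma transfer_exists:
  assumes A: "A \<in> sets M"
  obtains T :: "('b measure) \<Rightarrow> ('b \<Rightarrow> real) \<Rightarrow> 'a \<Rightarrow> real"
  where "\<And>M' g y. g \<in> borel_measurable M' \<Longrightarrow> 0 \<le> y \<Longrightarrow> distribution_fun M' g y < \<infinity> \<Longrightarrow>
      distribution_fun M' g 0 \<le> emeasure M A \<Longrightarrow>
      T M' g \<in> borel_measurable M \<and> (\<forall>\<omega>. T M' g \<omega> \<ge> 0) \<and> (\<forall>\<omega>. \<omega> \<notin> A \<longrightarrow> T M' g \<omega> = 0) \<and>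
      distribution_fun M (T M' g) = distribution_fun M' g"
    and "\<And>M' f g y \<omega>. f \<in> borel_measurable M' \<Longrightarrow> g \<in> borel_measurable M' \<Longrightarrow> 0 \<le> y \<Longrightarrow>
      distribution_fun M' g y < \<infinity> \<Longrightarrow> (AE \<omega> in M'. \<bar>f \<omega>\<bar> \<le> \<bar>g \<omega>\<bar>) \<Longrightarrow> T M' f \<omega> \<le> T M' g \<omega>"
proof -
  obtain \<phi> :: "'a \<Rightarrow> ennreal" where \<phi>: "\<phi> \<in> borel_measurable M" and pos: "\<And>\<omega>. \<phi> \<omega> > 0"
    and off: "\<And>\<omega>. \<omega> \<notin> A \<Longrightarrow> \<phi> \<omega> = \<infinity>"
    and lt: "\<And>t. emeasure M {\<omega> \<in> space M. \<phi> \<omega> < t} = min t (emeasure M A)"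
    by (rule uniform_fun_exists[OF A]) blast
  define T where "T M' g = transfer \<phi> (distribution_fun M' g)" for M' :: "'b measure" and g
  have gr: "T M' g \<omega> > y \<longleftrightarrow> \<phi> \<omega> < distribution_fun M' g y"
    if "g \<in> borel_measurable M'" "0 \<le> y0" "distribution_fun M' g y0 < \<infinity>" "0 \<le> y" for M' g y0 \<omega> y
    unfolding T_def by (rule transfer_greater_iff) (use that pos in auto)
  have nn: "T M' g \<omega> \<ge> 0"
    if "g \<in> borel_measurable M'" "0 \<le> y0" "distribution_fun M' g y0 < \<infinity>" for M' g y0 \<omega>
    unfolding T_def by (rule transfer_nonneg) (use that pos in auto)
  show ?thesis
  proof (rule that[of T], goal_cases)
    case (1 M' g y)
    note g = 1(1,2,3)
    have meas: "T M' g \<in> borel_measurable M"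
    proof (rule borel_measurable_iff_greater[THEN iffD2], intro allI)
      fix a :: real
      show "{\<omega> \<in> space M. a < T M' g \<omega>} \<in> sets M"
      proof (cases "a \<ge> 0")
        case True
        show ?thesis unfolding gr[OF g True] using \<phi> by measurable
      next
        case False
        hence "a < T M' g \<omega>" for \<omega> using nn[OF g, of \<omega>] by linarith
        hence "{\<omega> \<in> space M. a < T M' g \<omega>} = space M" by simp
        thus ?thesis by auto
      qed
    qed
    moreover have "T M' g \<omega> = 0" if "\<omega> \<notin> A" for \<omega>
      using gr[OF g order.refl, of \<omega>] nn[OF g, of \<omega>] off[OF that] by simp
    moreover have "distribution_fun M (T M' g) = distribution_fun M' g"
    proof (rule distribution_fun_eqI)
      fix x :: real assume x: "0 \<le> x"
      have "distribution_fun M (T M' g) x = min (distribution_fun M' g x) (emeasure M A)"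
        using x gr[OF g x] nn[OF g] lt by (simp add: distribution_fun_apply[of x M])
      moreover have "distribution_fun M' g x \<le> emeasure M A"
        using distribution_fun_antimono[OF g(1) order.refl x] 1(4) by order
      ultimately show "distribution_fun M (T M' g) x = distribution_fun M' g x" by (simp add: min_absorb1)
    qed
    ultimately show ?case using nn[OF g] by auto
  next
    case (2 M' f g y \<omega>)
    note fg = distribution_fun_mono[OF 2(2,5)]
    have ff: "distribution_fun M' f y < \<infinity>" using fg[OF 2(3)] 2(4) by order
    show ?case
    proof (rule ccontr)
      assume "\<not> ?case"
      hence *: "T M' g \<omega> < T M' f \<omega>" by simp
      have g0: "T M' g \<omega> \<ge> 0" using nn[OF 2(2,3,4)] .
      \<comment> \<open>The level \<open>T M' g \<omega>\<close> itself serves as the test level for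
        both functions.\<close>
      have "\<phi> \<omega> < distribution_fun M' f (T M' g \<omega>)" using gr[OF 2(1,3) ff g0] * by blast
      hence "\<phi> \<omega> < distribution_fun M' g (T M' g \<omega>)" using fg[OF g0] by order
      thus False using gr[OF 2(2,3,4) g0] by blast
    qed
  qed
qed

lemma equimeasurable_function_exists:
  fixes g :: "'b \<Rightarrow> real"
  assumes A: "A \<in> sets M" and g: "g \<in> borel_measurable M'"
    and y: "0 \<le> y" "distribution_fun M' g y < \<infinity>" and le: "distribution_fun M' g 0 \<le> emeasure M A"
  shows "\<exists>f. f \<in> borel_measurable M \<and> (\<forall>\<omega>. f \<omega> \<ge> 0) \<and> (\<forall>\<omega>. \<omega> \<notin> A \<longrightarrow> f \<omega> = 0) \<and>
    distribution_fun M f = distribution_fun M' g"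
proof (rule transfer_exists[OF A])
  fix T :: "'b measure \<Rightarrow> ('b \<Rightarrow> real) \<Rightarrow> 'a \<Rightarrow> real"
  assume "\<And>M' g y. g \<in> borel_measurable M' \<Longrightarrow> 0 \<le> y \<Longrightarrow> distribution_fun M' g y < \<infinity> \<Longrightarrow>
      distribution_fun M' g 0 \<le> emeasure M A \<Longrightarrow>
      T M' g \<in> borel_measurable M \<and> (\<forall>\<omega>. T M' g \<omega> \<ge> 0) \<and> (\<forall>\<omega>. \<omega> \<notin> A \<longrightarrow> T M' g \<omega> = 0) \<and>
      distribution_fun M (T M' g) = distribution_fun M' g"
  from this[OF g y le] show ?thesis by (rule exI[of _ "T M' g"])
qed

end

section \<open>Symmetric spaces\<close>

locale symmetric_function_space =
  fixes M :: "'a measure" and E :: "('a \<Rightarrow> real) set" and N :: "('a \<Rightarrow> real) \<Rightarrow> real"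
  assumes symmetric: "symmetric_space M E N"
begin

lemma measurable_mem: "f \<in> E \<Longrightarrow> f \<in> borel_measurable M"
  and zero_mem: "(\<lambda>\<omega>. 0) \<in> E"
  and add_mem: "f \<in> E \<Longrightarrow> g \<in> E \<Longrightarrow> (\<lambda>\<omega>. f \<omega> + g \<omega>) \<in> E"
  and scale_mem: "f \<in> E \<Longrightarrow> (\<lambda>\<omega>. c * f \<omega>) \<in> E"
  using symmetric unfolding symmetric_space_def L0_subspace_def by blast+

lemma norm_nonneg: "f \<in> E \<Longrightarrow> N f \<ge> 0"
  and norm_zero_iff: "f \<in> E \<Longrightarrow> N f = 0 \<longleftrightarrow> (AE \<omega> in M. f \<omega> = 0)"
  and norm_scale: "f \<in> E \<Longrightarrow> N (\<lambda>\<omega>. c * f \<omega>) = \<bar>c\<bar> * N f"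
  using symmetric unfolding symmetric_space_def quasi_norm_on_def by blast+

lemma solid:
  assumes "f \<in> borel_measurable M" "g \<in> E" "AE \<omega> in M. \<bar>f \<omega>\<bar> \<le> \<bar>g \<omega>\<bar>"
  shows "f \<in> E" "N f \<le> N g"
  using symmetric assms unfolding symmetric_space_def by blast+

lemma rearrangement_invariant:
  assumes "f \<in> borel_measurable M" "g \<in> E" "distribution_fun M f = distribution_fun M g"
  shows "f \<in> E" "N f = N g"
  using symmetric assms unfolding symmetric_space_def by blast+

lemma complete:
  assumes "\<And>n. f n \<in> E" "\<And>e. e > 0 \<Longrightarrow> \<exists>n0. \<forall>m\<ge>n0. \<forall>n\<ge>n0. N (\<lambda>\<omega>. f m \<omega> - f n \<omega>) < e"
  obtains g where "g \<in> E" "(\<lambda>n. N (\<lambda>\<omega>. f n \<omega> - g \<omega>)) \<longlonglongrightarrow> 0"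
  using symmetric assms unfolding symmetric_space_def quasi_norm_complete_def by blast

lemma nontrivial: "\<exists>f\<in>E. \<not> (AE \<omega> in M. f \<omega> = 0)"
  using symmetric unfolding symmetric_space_def by blast

lemma abs_mem: "f \<in> E \<Longrightarrow> (\<lambda>\<omega>. \<bar>f \<omega>\<bar>) \<in> E"
  using solid(1)[of "\<lambda>\<omega>. \<bar>f \<omega>\<bar>" f] measurable_mem[of f] by auto

lemma norm_abs: "f \<in> E \<Longrightarrow> N (\<lambda>\<omega>. \<bar>f \<omega>\<bar>) = N f"
  using solid(2)[of "\<lambda>\<omega>. \<bar>f \<omega>\<bar>" f] solid(2)[of f "\<lambda>\<omega>. \<bar>f \<omega>\<bar>"] abs_mem[of f] measurable_mem[of f] by auto

lemma diff_mem: "f \<in> E \<Longrightarrow> g \<in> E \<Longrightarrow> (\<lambda>\<omega>. f \<omega> - g \<omega>) \<in> E"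
  using add_mem[of f "\<lambda>\<omega>. -1 * g \<omega>"] scale_mem[of g "-1"] by simp

lemma norm_diff_commute: "f \<in> E \<Longrightarrow> g \<in> E \<Longrightarrow> N (\<lambda>\<omega>. f \<omega> - g \<omega>) = N (\<lambda>\<omega>. g \<omega> - f \<omega>)"
  using norm_scale[of "\<lambda>\<omega>. g \<omega> - f \<omega>" "-1"] diff_mem[of g f] by simp

lemma norm_zero: "N (\<lambda>\<omega>. 0) = 0"
  using norm_zero_iff[OF zero_mem] by simp

section \<open>Majorants of geometrically small sequences and comparison of quasi-norms\<close>

definition quasi_constant :: "real \<Rightarrow> bool" where
  "quasi_constant K \<longleftrightarrow> K \<ge> 1 \<and> (\<forall>f\<in>E. \<forall>g\<in>E. N (\<lambda>\<omega>. f \<omega> + g \<omega>) \<le> K * (N f + N g))"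

lemma quasi_constantD:
  assumes "quasi_constant K"
  shows "K \<ge> 1" "f \<in> E \<Longrightarrow> g \<in> E \<Longrightarrow> N (\<lambda>\<omega>. f \<omega> + g \<omega>) \<le> K * (N f + N g)"
  using assms unfolding quasi_constant_def by blast+

lemma quasi_constant_exists: obtains K where "quasi_constant K"
  using symmetric unfolding symmetric_space_def quasi_norm_on_def quasi_constant_def by blast

text \<open>The quasi-triangle inequality loses a factor \<open>K\<close> per addition, which the
  decay rate \<open>2 * K\<close> absorbs. Partial sums of the moduli are therefore Cauchy, and
  their limit \<open>H\<close> dominates them by solidity.\<close>

lemma geometric_series_majorant:
  assumes qc: "quasi_constant K"
    and h: "\<And>k. h k \<in> E" "\<And>k. N (h k) \<le> c / (2 * K) ^ Suc k"
  obtains H where "H \<in> E" "\<And>n. AE \<omega> in M. (\<Sum>k<n. \<bar>h k \<omega>\<bar>) \<le> H \<omega>" "N H \<le> K * c"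
proof -
  note K = quasi_constantD[OF qc]
  have K0: "K > 0" using K(1) by simp
  have "0 \<le> c / (2 * K) ^ Suc 0" using norm_nonneg[OF h(1)[of 0]] h(2)[of 0] by linarith
  hence c0: "c \<ge> 0" using K0 by (simp add: zero_le_divide_iff)
  define S where "S m d \<omega> = (\<Sum>k\<in>{m..<m+d}. \<bar>h k \<omega>\<bar>)" for m d \<omega>
  \<comment> \<open>Induction on the block length peels off the first term: both summands are at
    most \<open>c / (2 * K) ^ Suc m\<close>, and \<open>K\<close> times twice that is
    \<open>c / (2 * K) ^ m\<close>. The start \<open>m\<close> varies because the remaining block
    begins one later.\<close>
  have S: "S m d \<in> E \<and> N (S m d) \<le> c / (2 * K) ^ m" for m d
  proof (induction d arbitrary: m)
    case 0
    have "S m 0 = (\<lambda>\<omega>. 0)" unfolding S_def by simp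
    thus ?case using zero_mem norm_zero c0 K0 by simp
  next
    case (Suc d)
    have eq: "S m (Suc d) = (\<lambda>\<omega>. \<bar>h m \<omega>\<bar> + S (Suc m) d \<omega>)"
    proof
      show "S m (Suc d) \<omega> = \<bar>h m \<omega>\<bar> + S (Suc m) d \<omega>" for \<omega>
        unfolding S_def using sum.atLeast_Suc_lessThan[of m "m + Suc d" "\<lambda>k. \<bar>h k \<omega>\<bar>"]
        by (simp del: sum.op_ivl_Suc)
    qed
    have "N (S m (Suc d)) \<le> K * (N (h m) + N (S (Suc m) d))"
      unfolding eq using K(2)[OF abs_mem[OF h(1)[of m]], of "S (Suc m) d"] Suc[of "Suc m"] norm_abs[OF h(1)[of m]] by simp
    also have "\<dots> \<le> K * (c / (2 * K) ^ Suc m + c / (2 * K) ^ Suc m)"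
      using Suc[of "Suc m"] h(2)[of m] K0 by (intro mult_left_mono add_mono) auto
    also have "\<dots> = c / (2 * K) ^ m" using K0 by (simp add: field_simps)
    finally show ?case using add_mem[OF abs_mem[OF h(1)[of m]], of "S (Suc m) d"] Suc[of "Suc m"] eq by simp
  qed
  have diff: "S 0 n \<omega> - S 0 m \<omega> = S m (n - m) \<omega>" if "m \<le> n" for m n \<omega>
    unfolding S_def using sum.atLeastLessThan_concat[of 0 m n "\<lambda>k. \<bar>h k \<omega>\<bar>"] that by simp
  have lim: "(\<lambda>n. c / (2 * K) ^ n) \<longlonglongrightarrow> 0"
  proof -
    have "(\<lambda>n. c * (1 / (2 * K)) ^ n) \<longlonglongrightarrow> c * 0"
      by (intro tendsto_mult tendsto_const LIMSEQ_realpow_zero) (use K(1) in auto)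
    moreover have "c * (1 / (2 * K)) ^ n = c / (2 * K) ^ n" for n unfolding power_one_over by simp
    ultimately show ?thesis by simp
  qed
  have dec: "c / (2 * K) ^ n \<le> c / (2 * K) ^ m" if "m \<le> n" for m n
  proof (rule divide_left_mono[OF _ c0])
    show "(2 * K) ^ m \<le> (2 * K) ^ n" by (rule power_increasing[OF that]) (use K(1) in simp)
    show "0 < (2 * K) ^ n * (2 * K) ^ m" using K0 by simp
  qed
  obtain H where H: "H \<in> E" "(\<lambda>n. N (\<lambda>\<omega>. S 0 n \<omega> - H \<omega>)) \<longlonglongrightarrow> 0"
  proof (rule complete)
    show "S 0 n \<in> E" for n using S by simp
    fix e :: real assume "e > 0"
    then obtain n0 where n0: "c / (2 * K) ^ n0 < e"
      using order_tendstoD(2)[OF lim] by (auto simp: eventually_sequentially)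
    have *: "N (\<lambda>\<omega>. S 0 n \<omega> - S 0 m \<omega>) < e" if "n0 \<le> m" "m \<le> n" for m n
      using S[of m "n - m"] diff[OF that(2)] dec[OF that(1)] n0 by auto
    show "\<exists>n0. \<forall>m\<ge>n0. \<forall>n\<ge>n0. N (\<lambda>\<omega>. S 0 m \<omega> - S 0 n \<omega>) < e"
    proof (intro exI allI impI)
      fix m n assume "n0 \<le> m" "n0 \<le> n"
      thus "N (\<lambda>\<omega>. S 0 m \<omega> - S 0 n \<omega>) < e"
        using *[of m n] *[of n m] norm_diff_commute[of "S 0 m" "S 0 n"] S by (cases "m \<le> n") auto
    qed
  qed
  have maj: "AE \<omega> in M. S 0 n \<omega> \<le> H \<omega>" for n
  proof -
    \<comment> \<open>The positive part of the excess over \<open>H\<close> is dominated by the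
      modulus of \<open>S 0 m - H\<close> for every \<open>m \<ge> n\<close>, hence has quasi-norm
      0.\<close>
    define p where "p \<omega> = max 0 (S 0 n \<omega> - H \<omega>)" for \<omega>
    have pm: "p \<in> borel_measurable M" unfolding p_def
      using measurable_mem[OF H(1)] measurable_mem[OF conjunct1[OF S[of 0 n]]] by measurable
    have dom: "\<bar>p \<omega>\<bar> \<le> \<bar>S 0 m \<omega> - H \<omega>\<bar>" if "m \<ge> n" for m \<omega>
    proof -
      have "S 0 n \<omega> \<le> S 0 m \<omega>" unfolding S_def using that by (intro sum_mono2) auto
      thus ?thesis unfolding p_def by auto
    qed
    have pE: "p \<in> E" "N p \<le> N (\<lambda>\<omega>. S 0 m \<omega> - H \<omega>)" if "m \<ge> n" for m
      using solid[OF pm diff_mem[of "S 0 m" H]] S H(1) dom[OF that] by auto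
    have "N p \<le> 0"
      by (rule LIMSEQ_le_const[OF H(2)]) (use pE in auto)
    hence "AE \<omega> in M. p \<omega> = 0" using norm_zero_iff[OF pE(1)] norm_nonneg[OF pE(1)] by force
    thus ?thesis by eventually_elim (auto simp: p_def max_def split: if_splits)
  qed
  \<comment> \<open>A quasi-norm need not be continuous, so the bound on the partial sums passes to
    \<open>H\<close> at the cost of one more factor \<open>K\<close>.\<close>
  have "N H \<le> K * c"
  proof (rule LIMSEQ_le_const)
    have "(\<lambda>n. K * (c + N (\<lambda>\<omega>. S 0 n \<omega> - H \<omega>))) \<longlonglongrightarrow> K * (c + 0)"
      by (intro tendsto_intros H(2))
    thus "(\<lambda>n. K * (c + N (\<lambda>\<omega>. S 0 n \<omega> - H \<omega>))) \<longlonglongrightarrow> K * c" by simp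
    have "N H \<le> K * (c + N (\<lambda>\<omega>. S 0 n \<omega> - H \<omega>))" for n
    proof -
      have Sn: "S 0 n \<in> E" "N (S 0 n) \<le> c" using S[of 0 n] by auto
      have "N H = N (\<lambda>\<omega>. S 0 n \<omega> + (H \<omega> - S 0 n \<omega>))" by simp
      also have "\<dots> \<le> K * (N (S 0 n) + N (\<lambda>\<omega>. H \<omega> - S 0 n \<omega>))"
        by (rule K(2)) (use Sn H(1) diff_mem in auto)
      also have "\<dots> \<le> K * (c + N (\<lambda>\<omega>. S 0 n \<omega> - H \<omega>))"
        using Sn K0 norm_diff_commute[OF Sn(1) H(1)] by (intro mult_left_mono) auto
      finally show ?thesis .
    qed
    thus "\<exists>n0. \<forall>n\<ge>n0. N H \<le> K * (c + N (\<lambda>\<omega>. S 0 n \<omega> - H \<omega>))" by blast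
  qed
  thus ?thesis using that[of H] H(1) maj unfolding S_def by (simp add: atLeast0LessThan)
qed

text \<open>Multiples of \<open>f\<close> have the same distribution function if that function is constantly
  infinite, so homogeneity of \<open>N\<close> would force \<open>N f = 0\<close>.\<close>

lemma distribution_fun_finite:
  assumes f: "f \<in> E"
  obtains y where "0 \<le> y" "distribution_fun M f y < \<infinity>"
proof (rule ccontr)
  assume neg: "\<not> thesis"
  note witness = that
  have inf: "distribution_fun M f y = \<infinity>" if "0 \<le> y" for y
  proof (rule ccontr)
    assume "distribution_fun M f y \<noteq> \<infinity>"
    hence "distribution_fun M f y < \<infinity>" by (simp add: less_top)
    thus False using neg witness[OF that] by blast
  qed
  have "N (\<lambda>\<omega>. 2 * f \<omega>) = N f"
    by (rule rearrangement_invariant[OF measurable_mem[OF scale_mem[OF f]] f], rule distribution_fun_eqI)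
      (simp add: distribution_fun_scale inf)
  hence "N f = 0" using norm_scale[OF f, of 2] by simp
  thus False using norm_zero_iff[OF f] distribution_fun_zero_iff[OF measurable_mem[OF f]] inf[of 0] by simp
qed

text \<open>If no constant worked, members \<open>h k\<close> could be normalised to be
  geometrically small for \<open>N\<close> while \<open>N' (h k)\<close> exceeds
  \<open>Suc k\<close>. Their common majorant \<open>H\<close> lies in \<open>E\<close>, and
  solidity for \<open>N'\<close> makes \<open>N' H\<close> exceed every natural number.\<close>

lemma norm_dominates:
  assumes "symmetric_space M E N'"
  shows "\<exists>C>0. \<forall>f\<in>E. N' f \<le> C * N f"
proof (rule ccontr)
  interpret N': symmetric_function_space M E N' by unfold_locales (rule assms)
  obtain K where qc: "quasi_constant K" by (rule quasi_constant_exists)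
  note K = quasi_constantD(1)[OF qc]
  assume "\<not> ?thesis"
  hence neg: "\<exists>f\<in>E. N' f > C * N f" if "C > 0" for C using that by (auto simp: not_le)
  have K0: "K \<noteq> 0" using K by simp
  have "\<exists>f\<in>E. N' f > real (Suc k) * (2 * K) ^ Suc k * N f" for k
    by (rule neg) (use K in simp)
  then obtain f where f: "\<And>k. f k \<in> E" "\<And>k. N' (f k) > real (Suc k) * (2 * K) ^ Suc k * N (f k)" by metis
  \<comment> \<open>Normalising requires \<open>N (f k)\<close> to be nonzero; if it were zero,
    \<open>f k\<close> would vanish almost everywhere and \<open>N' (f k)\<close> would be zero
    too.\<close>
  have pos: "N (f k) > 0" for k
  proof (rule ccontr)
    assume "\<not> N (f k) > 0"
    hence "N (f k) = 0" using norm_nonneg[OF f(1)[of k]] by simp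
    moreover from this have "N' (f k) = 0" using norm_zero_iff[OF f(1)] N'.norm_zero_iff[OF f(1)] by blast
    ultimately show False using f(2)[of k] by simp
  qed
  define a where "a k = 1 / ((2 * K) ^ Suc k * N (f k))" for k
  have apos: "a k > 0" for k unfolding a_def using pos[of k] K by simp
  define h where "h k = (\<lambda>\<omega>. a k * f k \<omega>)" for k
  have hE: "h k \<in> E" for k unfolding h_def using scale_mem[OF f(1)] .
  have hN: "N (h k) \<le> 1 / (2 * K) ^ Suc k" for k
  proof -
    have "N (h k) = a k * N (f k)" unfolding h_def norm_scale[OF f(1)] using apos[of k] by simp
    also have "\<dots> = 1 / (2 * K) ^ Suc k" unfolding a_def using pos[of k] K0 by (simp del: power_Suc)
    finally show ?thesis by simp
  qed
  have hN': "N' (h k) > real (Suc k)" for k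
  proof -
    have "real (Suc k) = a k * (real (Suc k) * (2 * K) ^ Suc k * N (f k))"
      unfolding a_def using pos[of k] K0 by (simp del: power_Suc of_nat_Suc)
    also have "\<dots> < a k * N' (f k)"
      using f(2)[of k] apos[of k] by (rule mult_strict_left_mono)
    also have "\<dots> = N' (h k)" unfolding h_def using N'.norm_scale[OF f(1)] apos[of k] by simp
    finally show ?thesis .
  qed
  obtain H where H: "H \<in> E" "\<And>n. AE \<omega> in M. (\<Sum>k<n. \<bar>h k \<omega>\<bar>) \<le> H \<omega>"
    by (rule geometric_series_majorant[OF qc hE hN]) (rule that)
  have "real (Suc k) \<le> N' H" for k
  proof -
    have "AE \<omega> in M. \<bar>h k \<omega>\<bar> \<le> \<bar>H \<omega>\<bar>" using H(2)[of "Suc k"]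
    proof eventually_elim
      case (elim \<omega>)
      have "0 \<le> (\<Sum>j<k. \<bar>h j \<omega>\<bar>)" by (intro sum_nonneg) auto
      thus ?case using elim unfolding sum.lessThan_Suc by linarith
    qed
    hence "N' (h k) \<le> N' H" by (rule N'.solid(2)[OF measurable_mem[OF hE] H(1)])
    thus ?thesis using hN'[of k] by linarith
  qed
  moreover obtain k where "N' H < real k" using reals_Archimedean2 by blast
  hence "N' H < real (Suc k)" by simp
  ultimately show False using not_le by blast
qed

end

section \<open>The equimeasurable copy of a symmetric space\<close>

text \<open>For a level \<open>y \<ge> 0\<close> the set where \<open>|h k| > y\<close> lies in
  \<open>A k\<close>. Up to a null set the level set of \<open>F\<close> is therefore the disjoint
  union of those of the \<open>h k\<close>, and countable additivity applies.\<close>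

lemma distribution_fun_disjoint:
  assumes h: "\<And>k. h k \<in> borel_measurable M" and F: "F \<in> borel_measurable M"
    and A: "disjoint_family A" "\<And>k \<omega>. \<omega> \<notin> A k \<Longrightarrow> h k \<omega> = 0"
    and eq: "AE \<omega> in M. (\<forall>k. \<omega> \<in> A k \<longrightarrow> F \<omega> = h k \<omega>) \<and> (\<omega> \<notin> (\<Union>k. A k) \<longrightarrow> F \<omega> = 0)"
    and y: "0 \<le> y"
  shows "distribution_fun M F y = (\<Sum>k. distribution_fun M (h k) y)"
proof -
  let ?L = "\<lambda>k. {\<omega> \<in> space M. \<bar>h k \<omega>\<bar> > y}"
  have L: "?L k \<subseteq> A k" for k
  proof safe
    fix \<omega> assume "y < \<bar>h k \<omega>\<bar>"
    hence "h k \<omega> \<noteq> 0" using y by auto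
    thus "\<omega> \<in> A k" using A(2) by blast
  qed
  have "disjoint_family ?L" using A(1) L unfolding disjoint_family_on_def by blast
  moreover have Ls: "?L k \<in> sets M" for k using h[of k] by measurable
  ultimately have "(\<Sum>k. emeasure M (?L k)) = emeasure M (\<Union>k. ?L k)"
    by (intro suminf_emeasure) auto
  also have "\<dots> = emeasure M {\<omega> \<in> space M. \<bar>F \<omega>\<bar> > y}"
  proof (rule emeasure_eq_AE)
    show "AE \<omega> in M. \<omega> \<in> (\<Union>k. ?L k) \<longleftrightarrow> \<omega> \<in> {\<omega> \<in> space M. \<bar>F \<omega>\<bar> > y}"
      using eq
    proof eventually_elim
      case (elim \<omega>)
      show ?case
      proof (cases "\<exists>k. \<omega> \<in> A k")
        case True
        then obtain k where k: "\<omega> \<in> A k" by auto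
        have "j = k" if "\<omega> \<in> A j" for j
          using disjoint_family_onD[OF A(1), of j k] k that by auto
        hence "j = k" if "\<omega> \<in> ?L j" for j using L[of j] that by blast
        hence "\<omega> \<in> (\<Union>k. ?L k) \<longleftrightarrow> \<omega> \<in> ?L k" by blast
        moreover have "F \<omega> = h k \<omega>" using elim k by blast
        ultimately show ?thesis by auto
      next
        case False
        hence "F \<omega> = 0" using elim by blast
        moreover have "\<omega> \<notin> (\<Union>k. ?L k)" using L False by blast
        ultimately show ?thesis using y by auto
      qed
    qed
    show "(\<Union>k. ?L k) \<in> sets M" using Ls by blast
    show "{\<omega> \<in> space M. \<bar>F \<omega>\<bar> > y} \<in> sets M" using F by measurable
  qed
  finally show ?thesis using y by (simp add: distribution_fun_apply)
qed

text \<open>If every weighted increment were below \<open>s = |l - v m|\<close>, the increments from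
  \<open>m\<close> on would add up to at most \<open>s/4 + s/8 + ... = s/2\<close>, too little to
  reach \<open>l\<close>. This brings limits into the form of pointwise domination by some member of
  a sequence.\<close>

lemma limit_dominated_by_weighted_increment:
  fixes v :: "nat \<Rightarrow> real"
  assumes "v \<longlonglongrightarrow> l"
  shows "\<exists>k. \<bar>l - v m\<bar> \<le> 2 ^ (m + k + 2) * \<bar>v (Suc (m + k)) - v (m + k)\<bar>"
proof (rule ccontr)
  define s where "s = \<bar>l - v m\<bar>"
  assume "\<not> ?thesis"
  hence less: "2 ^ (m + k + 2) * \<bar>v (Suc (m + k)) - v (m + k)\<bar> < s" for k
    unfolding s_def by (meson not_le)
  have inc: "\<bar>v (Suc (m + k)) - v (m + k)\<bar> \<le> s / 2 ^ (k + 2)" for k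
  proof -
    have "2 ^ (k + 2) * \<bar>v (Suc (m + k)) - v (m + k)\<bar> \<le> 2 ^ (m + k + 2) * \<bar>v (Suc (m + k)) - v (m + k)\<bar>"
      by (intro mult_right_mono power_increasing) auto
    hence "2 ^ (k + 2) * \<bar>v (Suc (m + k)) - v (m + k)\<bar> \<le> s" using less[of k] by linarith
    thus ?thesis by (simp add: pos_le_divide_eq mult.commute del: power_Suc)
  qed
  have part: "\<bar>v (m + n) - v m\<bar> \<le> s / 2 - s / 2 ^ (n + 1)" for n
  proof (induction n)
    case (Suc n)
    have "\<bar>v (m + Suc n) - v m\<bar> \<le> \<bar>v (Suc (m + n)) - v (m + n)\<bar> + \<bar>v (m + n) - v m\<bar>" by simp
    also have "\<dots> \<le> s / 2 ^ (n + 2) + (s / 2 - s / 2 ^ (n + 1))" using inc Suc by (rule add_mono)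
    also have "\<dots> = s / 2 - s / 2 ^ (Suc n + 1)" by (simp add: field_simps)
    finally show ?case .
  qed simp
  have "0 < s" using le_less_trans[OF _ less[of 0]] by simp
  have "(\<lambda>n. \<bar>v (n + m) - v m\<bar>) \<longlonglongrightarrow> s"
    unfolding s_def by (intro tendsto_intros LIMSEQ_ignore_initial_segment assms)
  moreover have "\<bar>v (n + m) - v m\<bar> \<le> s / 2" for n
  proof -
    have "0 \<le> s / 2 ^ (n + 1)" using \<open>0 < s\<close> by simp
    thus ?thesis using part[of n] by (simp add: add.commute)
  qed
  ultimately have "s \<le> s / 2" by (intro LIMSEQ_le_const2) auto
  thus False using \<open>0 < s\<close> by simp
qed

text \<open>Bounded weighted increments are dominated by a geometric series, so the telescoping sum
  converges.\<close>

lemma summable_increments_convergent: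
  fixes v :: "nat \<Rightarrow> real"
  assumes "\<And>k. 2 ^ (k + 2) * \<bar>v (Suc k) - v k\<bar> \<le> B"
  shows "convergent v"
proof -
  have "summable (\<lambda>k. v (Suc k) - v k)"
  proof (rule summable_comparison_test')
    show "summable (\<lambda>k. B * (1 / 2) ^ k)" by (intro summable_mult summable_geometric) simp
    fix k :: nat
    have "2 ^ k * \<bar>v (Suc k) - v k\<bar> \<le> 2 ^ (k + 2) * \<bar>v (Suc k) - v k\<bar>"
      by (intro mult_right_mono power_increasing) auto
    hence "2 ^ k * \<bar>v (Suc k) - v k\<bar> \<le> B" using assms[of k] by linarith
    thus "norm (v (Suc k) - v k) \<le> B * (1 / 2) ^ k"
      by (simp add: power_one_over pos_le_divide_eq mult.commute)
  qed
  hence "convergent (\<lambda>n. \<Sum>k<n. v (Suc k) - v k)" by (simp add: summable_iff_convergent)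
  hence "convergent (\<lambda>n. v n - v 0)" by (simp add: sum_lessThan_telescope)
  from convergent_add[OF this convergent_const[of "v 0"]] show ?thesis by simp
qed

definition copy_space :: "'a measure \<Rightarrow> ('a \<Rightarrow> real) set \<Rightarrow> 'b measure \<Rightarrow> ('b \<Rightarrow> real) set" where
  "copy_space M E M' = {g \<in> borel_measurable M'. \<exists>f\<in>E. distribution_fun M f = distribution_fun M' g}"

text \<open>For a symmetric space the choice is immaterial on the copy: rearrangement invariance of
  \<open>N\<close> gives every candidate the same value.\<close>

definition copy_norm ::
  "'a measure \<Rightarrow> ('a \<Rightarrow> real) set \<Rightarrow> (('a \<Rightarrow> real) \<Rightarrow> real) \<Rightarrow> 'b measure \<Rightarrow> ('b \<Rightarrow> real) \<Rightarrow> real" where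
  "copy_norm M E N M' g = N (SOME f. f \<in> E \<and> distribution_fun M f = distribution_fun M' g)"

locale symmetric_copy = symmetric_function_space M1 E1 N1 +
  M1: nonatomic_measure_space M1 + M2: nonatomic_measure_space M2
  for M1 :: "'a measure" and M2 :: "'b measure" and E1 N1 +
  assumes total: "emeasure M1 (space M1) = emeasure M2 (space M2)"
begin

section \<open>Membership, solidity and quasi-norm of the copy\<close>

abbreviation "E2 \<equiv> copy_space M1 E1 M2"
abbreviation "N2 \<equiv> copy_norm M1 E1 N1 M2"

lemma copy_memI:
  assumes "g \<in> borel_measurable M2" "f \<in> E1" "distribution_fun M1 f = distribution_fun M2 g"
  shows "g \<in> E2" "N2 g = N1 f"
proof -
  show "g \<in> E2" using assms unfolding copy_space_def by blast
  define f' where "f' = (SOME f. f \<in> E1 \<and> distribution_fun M1 f = distribution_fun M2 g)"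
  have "f' \<in> E1 \<and> distribution_fun M1 f' = distribution_fun M2 g"
    unfolding f'_def by (rule someI[of _ f]) (use assms in auto)
  hence "N1 f' = N1 f" using rearrangement_invariant(2)[OF measurable_mem assms(2), of f'] assms(3) by auto
  thus "N2 g = N1 f" unfolding copy_norm_def f'_def .
qed

lemma copy_memE:
  assumes "g \<in> E2"
  obtains f where "f \<in> E1" "distribution_fun M1 f = distribution_fun M2 g" "N2 g = N1 f"
  using assms copy_memI(2)[of g] unfolding copy_space_def by blast

lemma copy_measurable: "g \<in> E2 \<Longrightarrow> g \<in> borel_measurable M2"
  unfolding copy_space_def by blast

lemma copy_finite:
  assumes "g \<in> E2"
  obtains y where "0 \<le> y" "distribution_fun M2 g y < \<infinity>"
  using copy_memE[OF assms] distribution_fun_finite by metis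

lemma copy_rearrangement_invariant:
  assumes "f \<in> borel_measurable M2" "g \<in> E2" "distribution_fun M2 f = distribution_fun M2 g"
  shows "f \<in> E2 \<and> N2 f = N2 g"
proof -
  obtain h where "h \<in> E1" "distribution_fun M1 h = distribution_fun M2 g" "N2 g = N1 h"
    using copy_memE[OF assms(2)] .
  thus ?thesis using copy_memI[OF assms(1), of h] assms(3) by simp
qed

lemma copy_nonneg: "g \<in> E2 \<Longrightarrow> N2 g \<ge> 0"
  by (erule copy_memE) (simp add: norm_nonneg)

lemma copy_scale:
  assumes "g \<in> E2"
  shows "(\<lambda>\<omega>. c * g \<omega>) \<in> E2" "N2 (\<lambda>\<omega>. c * g \<omega>) = \<bar>c\<bar> * N2 g"
proof -
  obtain f where f: "f \<in> E1" "distribution_fun M1 f = distribution_fun M2 g" "N2 g = N1 f"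
    using copy_memE[OF assms] .
  have "(\<lambda>\<omega>. c * g \<omega>) \<in> borel_measurable M2" using copy_measurable[OF assms] by measurable
  note * = copy_memI[OF this scale_mem[OF f(1)] distribution_fun_scale_cong[OF f(2)]]
  show "(\<lambda>\<omega>. c * g \<omega>) \<in> E2" by (rule *)
  show "N2 (\<lambda>\<omega>. c * g \<omega>) = \<bar>c\<bar> * N2 g" unfolding * f(3) by (rule norm_scale[OF f(1)])
qed

lemma copy_zero_iff:
  assumes "g \<in> E2"
  shows "N2 g = 0 \<longleftrightarrow> (AE \<omega> in M2. g \<omega> = 0)"
proof -
  obtain f where f: "f \<in> E1" "distribution_fun M1 f = distribution_fun M2 g" "N2 g = N1 f"
    using copy_memE[OF assms] .
  show ?thesis unfolding f(3) norm_zero_iff[OF f(1)]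
    using distribution_fun_zero_iff[OF measurable_mem[OF f(1)]] distribution_fun_zero_iff[OF copy_measurable[OF assms]]
    by (simp add: f(2))
qed

lemma copy_zero: "(\<lambda>\<omega>. 0) \<in> E2" "N2 (\<lambda>\<omega>. 0) = 0"
proof -
  have "distribution_fun M1 (\<lambda>\<omega>. 0) = distribution_fun M2 (\<lambda>\<omega>. 0)"
    by (rule distribution_fun_eqI) (simp add: distribution_fun_apply)
  from copy_memI[OF _ zero_mem this] norm_zero show "(\<lambda>\<omega>. 0) \<in> E2" "N2 (\<lambda>\<omega>. 0) = 0" by auto
qed

text \<open>Both functions are moved to the first space by the same monotone transfer, so the almost
  everywhere inequality of moduli becomes a pointwise one there, where solidity of \<open>E1\<close>
  applies.\<close>

lemma copy_solid:
  assumes f: "f \<in> borel_measurable M2" and g: "g \<in> E2" and le: "AE \<omega> in M2. \<bar>f \<omega>\<bar> \<le> \<bar>g \<omega>\<bar>"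
  shows "f \<in> E2 \<and> N2 f \<le> N2 g"
proof -
  note gm = copy_measurable[OF g]
  obtain y where y: "0 \<le> y" "distribution_fun M2 g y < \<infinity>" using copy_finite[OF g] .
  hence fy: "distribution_fun M2 f y < \<infinity>" using distribution_fun_mono[OF gm le y(1)] by order
  obtain T :: "'b measure \<Rightarrow> ('b \<Rightarrow> real) \<Rightarrow> 'a \<Rightarrow> real" where
    T: "\<And>M' g y. g \<in> borel_measurable M' \<Longrightarrow> 0 \<le> y \<Longrightarrow> distribution_fun M' g y < \<infinity> \<Longrightarrow>
      distribution_fun M' g 0 \<le> emeasure M1 (space M1) \<Longrightarrow>
      T M' g \<in> borel_measurable M1 \<and> (\<forall>\<omega>. T M' g \<omega> \<ge> 0) \<and> (\<forall>\<omega>. \<omega> \<notin> space M1 \<longrightarrow> T M' g \<omega> = 0) \<and>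
      distribution_fun M1 (T M' g) = distribution_fun M' g"
    and Tmono: "\<And>M' f g y \<omega>. f \<in> borel_measurable M' \<Longrightarrow> g \<in> borel_measurable M' \<Longrightarrow> 0 \<le> y \<Longrightarrow>
      distribution_fun M' g y < \<infinity> \<Longrightarrow> (AE \<omega> in M'. \<bar>f \<omega>\<bar> \<le> \<bar>g \<omega>\<bar>) \<Longrightarrow> T M' f \<omega> \<le> T M' g \<omega>"
    by (rule M1.transfer_exists[OF sets.top]) (rule that)
  have le_total: "distribution_fun M2 h 0 \<le> emeasure M1 (space M1)" for h
    using distribution_fun_le_total[of M2 h] total by simp
  note Tf = T[OF f y(1) fy le_total] and Tg = T[OF gm y le_total]
  obtain g' where g': "g' \<in> E1" "distribution_fun M1 g' = distribution_fun M2 g" "N2 g = N1 g'"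
    using copy_memE[OF g] .
  have Tg_mem: "T M2 g \<in> E1" "N1 (T M2 g) = N2 g"
    using rearrangement_invariant[OF _ g'(1), of "T M2 g"] Tg g' by auto
  have "\<bar>T M2 f \<omega>\<bar> \<le> \<bar>T M2 g \<omega>\<bar>" for \<omega>
    using Tmono[OF f gm y le, of \<omega>] conjunct1[OF conjunct2[OF Tf]] conjunct1[OF conjunct2[OF Tg]] by simp
  hence Tf_mem: "T M2 f \<in> E1" "N1 (T M2 f) \<le> N1 (T M2 g)" using solid[OF _ Tg_mem(1), of "T M2 f"] Tf by auto
  show ?thesis using copy_memI[OF f Tf_mem(1)] Tf Tf_mem(2) Tg_mem(2) by simp
qed

text \<open>The parts of \<open>g\<close> dominated by the different \<open>w k\<close> are moved onto disjoint subsets of the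
  other space and summed there; this replaces the transfer of joint distributions.\<close>

lemma copy_dominated:
  assumes K: "quasi_constant K"
    and w: "\<And>k. w k \<in> E2" "\<And>k. N2 (w k) \<le> c / (2 * K) ^ Suc k"
    and g: "g \<in> borel_measurable M2" and dom: "AE \<omega> in M2. \<exists>k. \<bar>g \<omega>\<bar> \<le> \<bar>w k \<omega>\<bar>"
  shows "g \<in> E2 \<and> N2 g \<le> K * c"
proof -
  \<comment> \<open>\<open>P k\<close> collects the points whose first dominating index is
    \<open>k\<close>; up to a null set these sets partition the space.\<close>
  define P where "P k = {\<omega> \<in> space M2. \<bar>g \<omega>\<bar> \<le> \<bar>w k \<omega>\<bar> \<and> (\<forall>j<k. \<bar>w j \<omega>\<bar> < \<bar>g \<omega>\<bar>)}" for k
  note [measurable] = g copy_measurable[OF w(1)]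
  have Ps[measurable]: "P k \<in> sets M2" for k unfolding P_def by measurable
  have Pd: "disjoint_family P"
  proof -
    have "P i \<inter> P j = {}" if "i < j" for i j using that unfolding P_def by (auto simp: not_le[symmetric])
    thus ?thesis unfolding disjoint_family_on_def by (metis Int_commute linorder_neqE)
  qed
  define gk where "gk k \<omega> = (if \<omega> \<in> P k then g \<omega> else 0)" for k \<omega>
  have gkm: "gk k \<in> borel_measurable M2" for k unfolding gk_def by measurable
  have gkE: "gk k \<in> E2 \<and> N2 (gk k) \<le> N2 (w k)" for k
    by (rule copy_solid[OF gkm w(1)]) (auto simp: gk_def P_def)
  \<comment> \<open>Equality of the total measures leaves room for disjoint sets \<open>A k\<close>
    at least as large as the \<open>P k\<close>.\<close>
  have "(\<Sum>k. emeasure M2 (P k)) \<le> emeasure M1 (space M1)"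
    unfolding total using suminf_emeasure[OF _ Pd] Ps emeasure_space[of M2] by (simp add: image_subset_iff)
  then obtain A :: "nat \<Rightarrow> 'a set"
    where A: "disjoint_family A" "\<And>k. A k \<in> sets M1" "\<And>k. emeasure M2 (P k) \<le> emeasure M1 (A k)"
    by (rule M1.disjoint_sets_of_given_measures) (rule that)
  have "\<exists>f. f \<in> borel_measurable M1 \<and> (\<forall>\<omega>. f \<omega> \<ge> 0) \<and> (\<forall>\<omega>. \<omega> \<notin> A k \<longrightarrow> f \<omega> = 0) \<and>
      distribution_fun M1 f = distribution_fun M2 (gk k)" for k
  proof -
    have le: "distribution_fun M2 (gk k) 0 \<le> emeasure M1 (A k)"
    proof -
      have "distribution_fun M2 (gk k) 0 \<le> emeasure M2 (P k)"
        unfolding distribution_fun_apply[OF order.refl] by (rule emeasure_mono) (auto simp: gk_def Ps split: if_splits)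
      thus ?thesis using A(3)[of k] by order
    qed
    obtain y where "0 \<le> y" "distribution_fun M2 (gk k) y < \<infinity>" using copy_finite[of "gk k"] gkE by blast
    thus ?thesis using M1.equimeasurable_function_exists[OF A(2) gkm _ _ le] by blast
  qed
  then obtain f where f: "\<And>k. f k \<in> borel_measurable M1" "\<And>k \<omega>. f k \<omega> \<ge> 0" "\<And>k \<omega>. \<omega> \<notin> A k \<Longrightarrow> f k \<omega> = 0"
    "\<And>k. distribution_fun M1 (f k) = distribution_fun M2 (gk k)" by metis
  have fE: "f k \<in> E1" "N1 (f k) \<le> c / (2 * K) ^ Suc k" for k
  proof -
    obtain h where h: "h \<in> E1" "distribution_fun M1 h = distribution_fun M2 (gk k)" "N2 (gk k) = N1 h"
      using copy_memE gkE[of k] by blast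
    have "f k \<in> E1 \<and> N1 (f k) = N1 h"
      using rearrangement_invariant[OF f(1) h(1), of k] f(4)[of k] h(2) by simp
    thus "f k \<in> E1" "N1 (f k) \<le> c / (2 * K) ^ Suc k" using h(3) gkE[of k] w(2)[of k] by auto
  qed
  obtain H where H: "H \<in> E1" "\<And>n. AE \<omega> in M1. (\<Sum>k<n. \<bar>f k \<omega>\<bar>) \<le> H \<omega>" "N1 H \<le> K * c"
    by (rule geometric_series_majorant[OF K fE]) (rule that)
  \<comment> \<open>At each point at most one \<open>f k\<close> is nonzero, so the series merely
    pastes the pieces together and lies below the majorant \<open>H\<close> almost
    everywhere.\<close>
  define F where "F \<omega> = (\<Sum>k. f k \<omega>)" for \<omega>
  have F_on: "F \<omega> = f k \<omega>" if "\<omega> \<in> A k" for k \<omega>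
  proof -
    have z: "f j \<omega> = 0" if "j \<notin> {k}" for j
      using f(3)[of \<omega> j] disjoint_family_onD[OF A(1), of j k] \<open>\<omega> \<in> A k\<close> that by auto
    show ?thesis unfolding F_def using suminf_finite[of "{k}" "\<lambda>j. f j \<omega>", OF _ z] by simp
  qed
  have F_off: "F \<omega> = 0" if "\<omega> \<notin> (\<Union>k. A k)" for \<omega>
  proof -
    have "f j \<omega> = 0" for j using that f(3) by blast
    thus ?thesis unfolding F_def by simp
  qed
  have Fm: "F \<in> borel_measurable M1" unfolding F_def using f(1) by measurable
  have "AE \<omega> in M1. \<forall>n. (\<Sum>k<n. \<bar>f k \<omega>\<bar>) \<le> H \<omega>" using H(2) by (simp add: AE_all_countable)
  hence "AE \<omega> in M1. \<bar>F \<omega>\<bar> \<le> \<bar>H \<omega>\<bar>"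
  proof eventually_elim
    case (elim \<omega>)
    show ?case
    proof (cases "\<omega> \<in> (\<Union>k. A k)")
      case True
      then obtain k where k: "\<omega> \<in> A k" by blast
      have "0 \<le> (\<Sum>j<k. \<bar>f j \<omega>\<bar>)" by (intro sum_nonneg) auto
      moreover have "(\<Sum>j<Suc k. \<bar>f j \<omega>\<bar>) \<le> H \<omega>" using elim by blast
      ultimately show ?thesis unfolding F_on[OF k] sum.lessThan_Suc by linarith
    next
      case False
      thus ?thesis using F_off by simp
    qed
  qed
  from solid[OF Fm H(1) this] have F: "F \<in> E1" "N1 F \<le> K * c" using H(3) by auto
  \<comment> \<open>Both \<open>F\<close> and \<open>g\<close> are pasted from disjointly supported
    pieces with matching distribution functions.\<close>
  have "distribution_fun M1 F = distribution_fun M2 g"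
  proof (rule distribution_fun_eqI)
    fix y :: real assume y: "0 \<le> y"
    have "distribution_fun M1 F y = (\<Sum>k. distribution_fun M1 (f k) y)"
      by (rule distribution_fun_disjoint[OF f(1) Fm A(1) f(3) _ y]) (use F_on F_off in auto)
    also have "\<dots> = (\<Sum>k. distribution_fun M2 (gk k) y)" unfolding f(4) ..
    also have "\<dots> = distribution_fun M2 g y"
    proof (rule distribution_fun_disjoint[OF gkm g Pd _ _ y, symmetric])
      show "gk k \<omega> = 0" if "\<omega> \<notin> P k" for k \<omega> using that by (simp add: gk_def)
      show "AE \<omega> in M2. (\<forall>k. \<omega> \<in> P k \<longrightarrow> g \<omega> = gk k \<omega>) \<and> (\<omega> \<notin> (\<Union>k. P k) \<longrightarrow> g \<omega> = 0)"
        using dom AE_space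
      proof eventually_elim
        case (elim \<omega>)
        define k where "k = (LEAST k. \<bar>g \<omega>\<bar> \<le> \<bar>w k \<omega>\<bar>)"
        have "\<bar>g \<omega>\<bar> \<le> \<bar>w k \<omega>\<bar>" unfolding k_def by (rule LeastI_ex) (use elim in blast)
        moreover have "\<bar>w j \<omega>\<bar> < \<bar>g \<omega>\<bar>" if "j < k" for j using not_less_Least[OF that[unfolded k_def]] by simp
        ultimately have "\<omega> \<in> P k" unfolding P_def using elim by blast
        thus ?case by (auto simp: gk_def)
      qed
    qed
    finally show "distribution_fun M1 F y = distribution_fun M2 g y" .
  qed
  thus ?thesis using copy_memI[OF g F(1)] F(2) by simp
qed

text \<open>On the set \<open>Z\<close> where the sequence is unbounded, every natural multiple of
  the indicator is dominated at each point by some \<open>w k\<close>. All these multiples have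
  quasi-norm at most \<open>K * c\<close>, so by homogeneity the indicator has quasi-norm 0.\<close>

lemma copy_bounded:
  assumes K: "quasi_constant K"
    and w: "\<And>k. w k \<in> E2" "\<And>k. N2 (w k) \<le> c / (2 * K) ^ Suc k"
  shows "AE \<omega> in M2. \<exists>B. \<forall>k. \<bar>w k \<omega>\<bar> \<le> B"
proof -
  define Z where "Z = {\<omega> \<in> space M2. \<forall>n::nat. \<exists>k. real n < \<bar>w k \<omega>\<bar>}"
  note [measurable] = copy_measurable[OF w(1)]
  have Zs[measurable]: "Z \<in> sets M2" unfolding Z_def by measurable
  have Z: "(\<lambda>\<omega>. real n * indicator Z \<omega>) \<in> E2 \<and> N2 (\<lambda>\<omega>. real n * indicator Z \<omega>) \<le> K * c" for n
  proof (rule copy_dominated[OF K w])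
    show "AE \<omega> in M2. \<exists>k. \<bar>real n * indicator Z \<omega>\<bar> \<le> \<bar>w k \<omega>\<bar>"
      by (rule AE_I2) (auto simp: indicator_def Z_def intro: less_imp_le)
  qed auto
  have Z1: "(indicator Z :: 'b \<Rightarrow> real) \<in> E2" using Z[of 1] by simp
  have bd: "real n * N2 (indicator Z) \<le> K * c" for n using Z[of n] copy_scale(2)[OF Z1, of "real n"] by simp
  have "N2 (indicator Z) = 0"
  proof (rule ccontr)
    assume "N2 (indicator Z) \<noteq> 0"
    hence "N2 (indicator Z) > 0" using copy_nonneg[OF Z1] by simp
    then obtain n where "K * c < real n * N2 (indicator Z)" using reals_Archimedean3 by blast
    thus False using bd[of n] by simp
  qed
  hence "AE \<omega> in M2. (indicator Z \<omega> :: real) = 0" using copy_zero_iff[OF Z1] by blast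
  thus ?thesis using AE_space
  proof eventually_elim
    case (elim \<omega>)
    hence "\<omega> \<notin> Z" by (auto simp: indicator_def)
    thus ?case unfolding Z_def using elim by (auto simp: not_less)
  qed
qed

text \<open>Pointwise \<open>|g + h|\<close> is at most the larger of \<open>|2 g|\<close> and
  \<open>|2 h|\<close>, so domination applies to the sequence
  \<open>2 g, 2 h, 0, 0, ...\<close>.\<close>

lemma copy_add:
  assumes K: "quasi_constant K"
    and g: "g \<in> E2" "h \<in> E2"
  shows "(\<lambda>\<omega>. g \<omega> + h \<omega>) \<in> E2 \<and> N2 (\<lambda>\<omega>. g \<omega> + h \<omega>) \<le> 8 * K ^ 3 * (N2 g + N2 h)"
proof -
  define w where "w k = (if k = 0 then (\<lambda>\<omega>. 2 * g \<omega>) else if k = 1 then (\<lambda>\<omega>. 2 * h \<omega>) else (\<lambda>\<omega>. 0))" for k :: nat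
  \<comment> \<open>Chosen for index 1, where \<open>c / (2 * K) ^ 2\<close> is twice
    \<open>N2 g + N2 h\<close>; index 0 then follows from \<open>K \<ge> 1\<close>.\<close>
  define c where "c = 8 * K ^ 2 * (N2 g + N2 h)"
  have n: "N2 g \<ge> 0" "N2 h \<ge> 0" using g by (auto intro: copy_nonneg)
  have K1: "K \<ge> 1" by (rule quasi_constantD(1)[OF K])
  hence K0: "K > 0" by simp
  have c0: "c \<ge> 0" unfolding c_def using n by simp
  have "(\<lambda>\<omega>. g \<omega> + h \<omega>) \<in> E2 \<and> N2 (\<lambda>\<omega>. g \<omega> + h \<omega>) \<le> K * c"
  proof (rule copy_dominated[OF K])
    show "w k \<in> E2" for k unfolding w_def using copy_scale(1) copy_zero g by simp
    show "N2 (w k) \<le> c / (2 * K) ^ Suc k" for k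
    proof -
      consider "k = 0" | "k = 1" | "k \<ge> 2" by linarith
      thus ?thesis
      proof cases
        case 1
        have "c / (2 * K) ^ Suc k = 4 * K * (N2 g + N2 h)" unfolding c_def 1 using K0 by (simp add: power2_eq_square)
        moreover have "4 * 1 * (N2 g + N2 h) \<le> 4 * K * (N2 g + N2 h)"
          by (intro mult_right_mono mult_left_mono) (use K1 n in auto)
        ultimately show ?thesis using copy_scale(2)[OF g(1), of 2] n 1 by (simp add: w_def)
      next
        case 2
        have "c / (2 * K) ^ Suc k = 2 * (N2 g + N2 h)" unfolding c_def 2 using K0 by (simp add: power2_eq_square)
        thus ?thesis using copy_scale(2)[OF g(2), of 2] n 2 by (simp add: w_def)
      next
        case 3
        have "0 \<le> c / (2 * K) ^ Suc k" using c0 K0 by simp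
        thus ?thesis using 3 copy_zero(2) by (simp add: w_def)
      qed
    qed
    show "(\<lambda>\<omega>. g \<omega> + h \<omega>) \<in> borel_measurable M2" using g[THEN copy_measurable] by measurable
    show "AE \<omega> in M2. \<exists>k. \<bar>g \<omega> + h \<omega>\<bar> \<le> \<bar>w k \<omega>\<bar>"
    proof (rule AE_I2)
      fix \<omega>
      have "\<bar>g \<omega> + h \<omega>\<bar> \<le> \<bar>w 0 \<omega>\<bar> \<or> \<bar>g \<omega> + h \<omega>\<bar> \<le> \<bar>w 1 \<omega>\<bar>" unfolding w_def by (simp, linarith)
      thus "\<exists>k. \<bar>g \<omega> + h \<omega>\<bar> \<le> \<bar>w k \<omega>\<bar>" by blast
    qed
  qed
  moreover have "K * c = 8 * K ^ 3 * (N2 g + N2 h)" unfolding c_def by (simp add: power2_eq_square power3_eq_cube)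
  ultimately show ?thesis by simp
qed

section \<open>Completeness of the copy\<close>

lemma copy_diff: "g \<in> E2 \<Longrightarrow> h \<in> E2 \<Longrightarrow> (\<lambda>\<omega>. g \<omega> - h \<omega>) \<in> E2"
  by (rule quasi_constant_exists) (use copy_add[of _ g "\<lambda>\<omega>. -1 * h \<omega>"] copy_scale(1)[of h "-1"] in auto)

text \<open>A rapidly converging subsequence \<open>v\<close> has weighted increments
  \<open>w\<close> that still decay geometrically. Their boundedness gives a pointwise limit
  \<open>g\<close>, and at almost every point \<open>g - v m\<close> is dominated by some
  \<open>w k\<close> with \<open>k \<ge> m\<close>, which bounds its quasi-norm by a null sequence
  in \<open>m\<close>.\<close>

lemma copy_complete: "quasi_norm_complete E2 N2"
  unfolding quasi_norm_complete_def
proof (intro allI impI, elim conjE)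
  fix u :: "nat \<Rightarrow> 'b \<Rightarrow> real"
  assume u: "\<forall>n. u n \<in> E2"
    and cauchy: "\<forall>e>0. \<exists>n0. \<forall>m\<ge>n0. \<forall>n\<ge>n0. N2 (\<lambda>\<omega>. u m \<omega> - u n \<omega>) < e"
  obtain K where K: "quasi_constant K" by (rule quasi_constant_exists)
  have K1: "K \<ge> 1" by (rule quasi_constantD(1)[OF K])
  hence K0: "K > 0" by simp
  \<comment> \<open>Of the rate \<open>8 * K\<close>, a factor 2 pays for the weights in
    \<open>w\<close>; the remaining \<open>4 * K\<close> meets the rate \<open>2 * K\<close>
    required for domination.\<close>
  define d where "d k = 1 / (8 * K) ^ Suc k" for k
  have d0: "d k > 0" for k unfolding d_def using K0 by simp
  have "\<forall>k. \<exists>n0. \<forall>m\<ge>n0. \<forall>n\<ge>n0. N2 (\<lambda>\<omega>. u m \<omega> - u n \<omega>) < d k"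
    by (intro allI cauchy[rule_format] d0)
  from choice[OF this] obtain n0 where "\<forall>k. \<forall>m\<ge>n0 k. \<forall>n\<ge>n0 k. N2 (\<lambda>\<omega>. u m \<omega> - u n \<omega>) < d k" ..
  hence n0: "N2 (\<lambda>\<omega>. u m \<omega> - u n \<omega>) < d k" if "m \<ge> n0 k" "n \<ge> n0 k" for k m n using that by simp
  \<comment> \<open>Summing the thresholds yields nondecreasing indices with
    \<open>n0 k \<le> r k\<close>.\<close>
  define r where "r k = (\<Sum>j\<le>k. n0 j)" for k
  have r: "n0 k \<le> r k" "r k \<le> r (Suc k)" for k
    unfolding r_def using member_le_sum[of k "{..k}" n0] by auto
  define v where "v k = u (r k)" for k
  have vE: "v k \<in> E2" for k unfolding v_def using u by blast
  define w where "w k = (\<lambda>\<omega>. 2 ^ (k + 2) * (v (Suc k) \<omega> - v k \<omega>))" for k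
  have wE: "w k \<in> E2" for k unfolding w_def by (intro copy_scale(1) copy_diff vE)
  have wN: "N2 (w k) \<le> 2 / (4 * K) ^ Suc k" for k
  proof -
    have "N2 (w k) = 2 ^ (k + 2) * N2 (\<lambda>\<omega>. v (Suc k) \<omega> - v k \<omega>)"
      unfolding w_def using copy_scale(2)[OF copy_diff[OF vE[of "Suc k"] vE[of k]], of "2 ^ (k + 2)"] by simp
    also have "\<dots> \<le> 2 ^ (k + 2) * d k"
    proof (rule mult_left_mono)
      have "n0 k \<le> r (Suc k)" using r[of k] by simp
      thus "N2 (\<lambda>\<omega>. v (Suc k) \<omega> - v k \<omega>) \<le> d k" unfolding v_def using n0[of k "r (Suc k)" "r k"] r(1)[of k] by simp
    qed simp
    finally have le: "N2 (w k) \<le> 2 ^ (k + 2) * d k" .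
    have e: "(8 * K) ^ Suc k = 2 ^ Suc k * (4 * K) ^ Suc k" unfolding power_mult_distrib[symmetric] by simp
    have "(2::real) ^ (k + 2) = 2 * 2 ^ Suc k" by simp
    hence "2 ^ (k + 2) * d k = 2 / (4 * K) ^ Suc k"
      unfolding d_def e by (simp del: power_Suc power_mult_distrib)
    thus ?thesis using le by simp
  qed
  \<comment> \<open>Seen from index \<open>m\<close> on, the sequence satisfies the domination
    hypothesis with constant \<open>2 / (4 * K) ^ m\<close>, which tends to 0 as \<open>m\<close>
    grows.\<close>
  have wN': "N2 (w (m + k)) \<le> (2 / (4 * K) ^ m) / (2 * K) ^ Suc k" for m k
  proof -
    have "(2 * K) ^ Suc k \<le> (4 * K) ^ Suc k" using K0 by (intro power_mono) auto
    hence "(4 * K) ^ m * (2 * K) ^ Suc k \<le> (4 * K) ^ m * (4 * K) ^ Suc k"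
      using K0 by (intro mult_left_mono) auto
    also have "\<dots> = (4 * K) ^ Suc (m + k)" unfolding power_add[symmetric] by simp
    finally have "2 / (4 * K) ^ Suc (m + k) \<le> 2 / ((4 * K) ^ m * (2 * K) ^ Suc k)"
      using K0 by (intro divide_left_mono) auto
    thus ?thesis using wN[of "m + k"] by (simp del: power_Suc)
  qed
  have "AE \<omega> in M2. \<exists>B. \<forall>k. \<bar>w k \<omega>\<bar> \<le> B"
    by (rule copy_bounded[OF K wE, where c = 2]) (use wN'[of 0] in simp)
  hence conv: "AE \<omega> in M2. convergent (\<lambda>k. v k \<omega>)"
  proof eventually_elim
    case (elim \<omega>)
    then obtain B where "\<And>k. \<bar>w k \<omega>\<bar> \<le> B" by blast
    thus ?case by (intro summable_increments_convergent[of "\<lambda>k. v k \<omega>" B]) (simp add: w_def abs_mult)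
  qed
  \<comment> \<open>Points where the subsequence diverges form a null set; there \<open>lim\<close>
    has no meaningful value.\<close>
  define g where "g \<omega> = lim (\<lambda>k. v k \<omega>)" for \<omega>
  note [measurable] = copy_measurable[OF vE]
  have gm[measurable]: "g \<in> borel_measurable M2" unfolding g_def by measurable
  have tail: "(\<lambda>\<omega>. g \<omega> - v m \<omega>) \<in> E2 \<and> N2 (\<lambda>\<omega>. g \<omega> - v m \<omega>) \<le> K * (2 / (4 * K) ^ m)" for m
  proof (rule copy_dominated[OF K wE wN'])
    show "(\<lambda>\<omega>. g \<omega> - v m \<omega>) \<in> borel_measurable M2" by measurable
    show "AE \<omega> in M2. \<exists>k. \<bar>g \<omega> - v m \<omega>\<bar> \<le> \<bar>w (m + k) \<omega>\<bar>" using conv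
    proof eventually_elim
      case (elim \<omega>)
      hence "(\<lambda>k. v k \<omega>) \<longlonglongrightarrow> g \<omega>" unfolding g_def by (simp add: convergent_LIMSEQ_iff)
      from limit_dominated_by_weighted_increment[OF this, of m] show ?case by (simp add: w_def abs_mult)
    qed
  qed
  note add = copy_add[OF K]
  have gE: "g \<in> E2"
    using add[OF conjunct1[OF tail[of 0]] vE[of 0]] by simp
  \<comment> \<open>The bound that \<open>copy_add\<close> gives for the sum of
    \<open>u n - v k\<close> and \<open>v k - g\<close>.\<close>
  define b where "b k = 8 * K ^ 3 * (d k + K * (2 / (4 * K) ^ k))" for k
  have "b \<longlonglongrightarrow> 0"
  proof -
    have "(\<lambda>k. 8 * K ^ 3 * ((1 / (8 * K)) ^ Suc k + K * (2 * (1 / (4 * K)) ^ k))) \<longlonglongrightarrow> 8 * K ^ 3 * (0 + K * (2 * 0))"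
      by (intro tendsto_intros LIMSEQ_Suc LIMSEQ_realpow_zero) (use K0 K1 in auto)
    thus ?thesis unfolding b_def d_def power_one_over by simp
  qed
  have close: "N2 (\<lambda>\<omega>. u n \<omega> - g \<omega>) \<le> b k" if "n \<ge> r k" for n k
  proof -
    have un: "u n \<in> E2" using u by blast
    have "N2 (\<lambda>\<omega>. v k \<omega> - g \<omega>) = N2 (\<lambda>\<omega>. g \<omega> - v k \<omega>)"
      using copy_scale(2)[OF conjunct1[OF tail[of k]], of "-1"] by simp
    hence vg: "N2 (\<lambda>\<omega>. v k \<omega> - g \<omega>) \<le> K * (2 / (4 * K) ^ k)" using tail[of k] by simp
    have uv: "N2 (\<lambda>\<omega>. u n \<omega> - v k \<omega>) \<le> d k"
      unfolding v_def using n0[of k n "r k"] r(1)[of k] that by simp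
    have "N2 (\<lambda>\<omega>. u n \<omega> - g \<omega>) = N2 (\<lambda>\<omega>. (u n \<omega> - v k \<omega>) + (v k \<omega> - g \<omega>))" by simp
    also have "\<dots> \<le> 8 * K ^ 3 * (N2 (\<lambda>\<omega>. u n \<omega> - v k \<omega>) + N2 (\<lambda>\<omega>. v k \<omega> - g \<omega>))"
      using add[OF copy_diff[OF un vE] copy_diff[OF vE gE]] by blast
    also have "\<dots> \<le> b k" unfolding b_def using uv vg K0 by (intro mult_left_mono add_mono) auto
    finally show ?thesis .
  qed
  have "(\<lambda>n. N2 (\<lambda>\<omega>. u n \<omega> - g \<omega>)) \<longlonglongrightarrow> 0"
  proof (rule LIMSEQ_I)
    fix e :: real assume "e > 0"
    then obtain k where "b k < e" using order_tendstoD(2)[OF \<open>b \<longlonglongrightarrow> 0\<close>] by (auto simp: eventually_sequentially)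
    moreover have "N2 (\<lambda>\<omega>. u n \<omega> - g \<omega>) \<ge> 0" for n using u gE by (intro copy_nonneg copy_diff) auto
    ultimately show "\<exists>no. \<forall>n\<ge>no. norm (N2 (\<lambda>\<omega>. u n \<omega> - g \<omega>) - 0) < e"
      using close[of k] by (intro exI[of _ "r k"]) (auto intro: le_less_trans)
  qed
  thus "\<exists>g\<in>E2. (\<lambda>n. N2 (\<lambda>\<omega>. u n \<omega> - g \<omega>)) \<longlonglongrightarrow> 0" using gE by blast
qed

text \<open>Realisation on the second space uses a finite level, which membership in
  \<open>E1\<close> supplies, and enough room, which equality of the total measures
  supplies.\<close>

lemma copy_of_function:
  assumes f: "f \<in> E1"
  obtains g where "g \<in> E2" "distribution_fun M1 f = distribution_fun M2 g"
proof -
  obtain y where y: "0 \<le> y" "distribution_fun M1 f y < \<infinity>" using distribution_fun_finite[OF f] .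
  have "distribution_fun M1 f 0 \<le> emeasure M2 (space M2)"
    using distribution_fun_le_total[of M1 f] total by simp
  then obtain g where "g \<in> borel_measurable M2" "distribution_fun M2 g = distribution_fun M1 f"
    using M2.equimeasurable_function_exists[OF sets.top measurable_mem[OF f] y] by blast
  thus ?thesis using that[of g] copy_memI(1)[OF _ f] by metis
qed

section \<open>Symmetry, equimeasurability and uniqueness of the copy\<close>

lemma copy_symmetric: "symmetric_space M2 E2 N2"
proof -
  obtain K where K: "quasi_constant K" by (rule quasi_constant_exists)
  \<comment> \<open>Invariance under almost everywhere equality follows from solidity applied in
    both directions.\<close>
  have cong: "f \<in> E2 \<and> N2 f = N2 g" if "f \<in> borel_measurable M2" "g \<in> E2" "AE \<omega> in M2. f \<omega> = g \<omega>" for f g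
  proof -
    have "AE \<omega> in M2. \<bar>f \<omega>\<bar> \<le> \<bar>g \<omega>\<bar>" "AE \<omega> in M2. \<bar>g \<omega>\<bar> \<le> \<bar>f \<omega>\<bar>"
      using that(3) by (eventually_elim, simp)+
    thus ?thesis using copy_solid[OF that(1,2)] copy_solid[OF copy_measurable[OF that(2)], of f] by force
  qed
  have "L0_subspace M2 E2"
    unfolding L0_subspace_def using copy_measurable cong copy_zero(1) copy_add[OF K] copy_scale(1) by blast
  moreover have "quasi_norm_on M2 E2 N2"
    unfolding quasi_norm_on_def
  proof (intro conjI)
    show "\<forall>f\<in>E2. \<forall>g\<in>E2. (AE \<omega> in M2. f \<omega> = g \<omega>) \<longrightarrow> N2 f = N2 g" using cong copy_measurable by blast
    show "\<exists>K\<ge>1. \<forall>f\<in>E2. \<forall>g\<in>E2. N2 (\<lambda>\<omega>. f \<omega> + g \<omega>) \<le> K * (N2 f + N2 g)"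
    proof (intro exI conjI)
      show "1 \<le> 8 * K ^ 3" using one_le_power[OF quasi_constantD(1)[OF K], of 3] by simp
    qed (use copy_add[OF K] in blast)
  qed (use copy_nonneg copy_zero_iff copy_scale(2) in blast)+
  moreover have "\<exists>g\<in>E2. \<not> (AE \<omega> in M2. g \<omega> = 0)"
  proof -
    obtain f where f: "f \<in> E1" "\<not> (AE \<omega> in M1. f \<omega> = 0)" using nontrivial by blast
    obtain g where g: "g \<in> E2" "distribution_fun M1 f = distribution_fun M2 g" using copy_of_function[OF f(1)] .
    hence "\<not> (AE \<omega> in M2. g \<omega> = 0)"
      using distribution_fun_zero_iff[OF measurable_mem[OF f(1)]] distribution_fun_zero_iff[OF copy_measurable[OF g(1)]] f(2)
      by simp
    thus ?thesis using g(1) by blast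
  qed
  ultimately show ?thesis
    unfolding symmetric_space_def using copy_complete copy_solid copy_rearrangement_invariant by blast
qed

lemma copy_equimeasurable: "equimeasurable M1 E1 M2 E2"
  unfolding equimeasurable_def
proof
  show "decr_rearrangement M1 ` E1 \<subseteq> decr_rearrangement M2 ` E2"
  proof (rule image_subsetI)
    fix f assume f: "f \<in> E1"
    obtain g where "g \<in> E2" "distribution_fun M1 f = distribution_fun M2 g" using copy_of_function[OF f] .
    thus "decr_rearrangement M1 f \<in> decr_rearrangement M2 ` E2"
      using decr_rearrangement_eq_iff[OF measurable_mem[OF f] copy_measurable] by blast
  qed
  show "decr_rearrangement M2 ` E2 \<subseteq> decr_rearrangement M1 ` E1"
  proof (rule image_subsetI)
    fix g assume g: "g \<in> E2"
    obtain f where "f \<in> E1" "distribution_fun M1 f = distribution_fun M2 g" using copy_memE[OF g] .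
    thus "decr_rearrangement M2 g \<in> decr_rearrangement M1 ` E1"
      using decr_rearrangement_eq_iff[OF measurable_mem copy_measurable[OF g]] by (metis imageI)
  qed
qed

text \<open>Equal rearrangements mean equal distribution functions. One inclusion is then the
  definition of the copy, and the other is rearrangement invariance of \<open>E\<close>.\<close>

lemma copy_unique:
  assumes "symmetric_space M2 E N" "equimeasurable M1 E1 M2 E"
  shows "E = E2"
proof -
  interpret E: symmetric_function_space M2 E N by unfold_locales (rule assms)
  have img: "decr_rearrangement M1 ` E1 = decr_rearrangement M2 ` E" using assms(2) unfolding equimeasurable_def .
  show ?thesis
  proof
    show "E \<subseteq> E2"
    proof
      fix g assume g: "g \<in> E"
      hence "decr_rearrangement M2 g \<in> decr_rearrangement M1 ` E1" unfolding img by (rule imageI)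
      then obtain f where f: "f \<in> E1" "decr_rearrangement M1 f = decr_rearrangement M2 g" by force
      hence "distribution_fun M1 f = distribution_fun M2 g"
        using decr_rearrangement_eq_iff[OF measurable_mem E.measurable_mem[OF g]] by blast
      thus "g \<in> E2" by (rule copy_memI(1)[OF E.measurable_mem[OF g] f(1)])
    qed
    show "E2 \<subseteq> E"
    proof
      fix g assume g: "g \<in> E2"
      obtain f where f: "f \<in> E1" "distribution_fun M1 f = distribution_fun M2 g" using copy_memE[OF g] .
      have "decr_rearrangement M1 f \<in> decr_rearrangement M2 ` E" using f(1) unfolding img[symmetric] by (rule imageI)
      then obtain h where h: "h \<in> E" "decr_rearrangement M1 f = decr_rearrangement M2 h" by force
      hence "distribution_fun M2 g = distribution_fun M2 h"
        using decr_rearrangement_eq_iff[OF measurable_mem[OF f(1)] E.measurable_mem[OF h(1)]] f(2) by simp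
      thus "g \<in> E" by (rule E.rearrangement_invariant(1)[OF copy_measurable[OF g] h(1)])
    qed
  qed
qed

end

text \<open>Each quasi-norm is bounded by a multiple of the other; inverting the reverse bound gives
  the lower constant \<open>1 / D\<close>.\<close>

lemma same_quasi_banach_spaceI:
  assumes "symmetric_space M E N" "symmetric_space M E N'"
  shows "same_quasi_banach_space E N E N'"
proof -
  obtain C where C: "C > 0" "\<And>f. f \<in> E \<Longrightarrow> N' f \<le> C * N f"
    using symmetric_function_space.norm_dominates[OF symmetric_function_space.intro[OF assms(1)] assms(2)] by blast
  obtain D where D: "D > 0" "\<And>f. f \<in> E \<Longrightarrow> N f \<le> D * N' f"
    using symmetric_function_space.norm_dominates[OF symmetric_function_space.intro[OF assms(2)] assms(1)] by blast
  have "1 / D * N f \<le> N' f" if "f \<in> E" for f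
    using D(2)[OF that] D(1) by (simp add: pos_divide_le_eq mult.commute)
  moreover have "1 / D > 0" using D(1) by simp
  ultimately show ?thesis unfolding same_quasi_banach_space_def using C by blast
qed

theorem mainTheorem1:
  fixes M1 :: "'a measure" and M2 :: "'b measure"
    and E1 :: "('a \<Rightarrow> real) set" and N1 :: "('a \<Rightarrow> real) \<Rightarrow> real"
  assumes "nonatomic_measure_space M1" and "nonatomic_measure_space M2"
    and "emeasure M1 (space M1) = emeasure M2 (space M2)"
    and "symmetric_space M1 E1 N1"
  shows "\<exists>E2 N2. symmetric_space M2 E2 N2 \<and> equimeasurable M1 E1 M2 E2 \<and>
           (\<forall>E N. symmetric_space M2 E N \<and> equimeasurable M1 E1 M2 E \<longrightarrow>
              same_quasi_banach_space E2 N2 E N)"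
proof -
  interpret M1: nonatomic_measure_space M1 by (rule assms)
  interpret M2: nonatomic_measure_space M2 by (rule assms)
  interpret symmetric_copy M1 M2 E1 N1 by unfold_locales (use assms in auto)
  \<comment> \<open>Uniqueness has two stages: \<open>copy_unique\<close> identifies the sets of
    functions, and then the two quasi-norms on that set are compared.\<close>
  have "same_quasi_banach_space E2 N2 E N"
    if "symmetric_space M2 E N" "equimeasurable M1 E1 M2 E" for E N
    using same_quasi_banach_spaceI[OF copy_symmetric, of N] that copy_unique[OF that] by simp
  thus ?thesis using copy_symmetric copy_equimeasurable by blast
qed

end
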